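(* Let $K$ be a field, $H$ a free abelian group of finite rank, and $\alpha:H\times H\to K^*$ a map with $\alpha(h,g)=\alpha(g,h)^{-1}$ and $\alpha(h_1+h_2,g)=\alpha(h_1,g)\alpha(h_2,g)$. Let $B$ be an abelian group, $\mathcal L:B\to\mathcal G(H,\alpha)$ a theta multiplier, $[c_{l,b};x_{l,b},h_{l,b},0]$ the left representative of $\mathcal L(b)$, $h^-_b:=h_{l,b}$, and $h^-:B\to H$ the homomorphism $b\mapsto h^-_b$. (a) We have $$\dim\Gamma(\mathcal L)\le[H:h^-(B)].$$ Equality holds if $x_{l,b},c_{l,b}$ depend only on $h^-_b$, for example, if $h^-:B\to H$ is an embedding. (b) Let the last condition be satisfied, i.e. let $x_{l,b},c_{l,b}$ depend only on $h^-_b$. Assume that $K$ is a normed field. Then all theta functions with multiplier $\mathcal L$ are analytic if $[H:h^-(B)]<\infty$ and $b\mapsto\log|\langle b,b\rangle|$ is a negative definite quadratic form on $B$, where $\langle b_1,b_2\rangle:=h^-_{b_2}(x_{l,b_1})\,\alpha(h^-_{b_1},h^-_{b_2})$. In this case $\mathrm{rk}\,B=\mathrm{rk}\,H$, and $B$ (that is, its image under the period map $b\mapsto x_{l,b}$) is discrete in $T(H,1)(K)$. Such multipliers are called ample.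
   Context: $T(H,1)(K):=\mathrm{Hom}(H,K^* )$, written multiplicatively (when $K$ is normed it carries the topology induced by $\mathrm{Hom}(H,K^* )\cong(K^* )^{\mathrm{rk} H}$); for $x\in T(H,1)(K)$ and $h\in H$, $h(x)\in K^*$ denotes the value of $x$ at $h$. For $h\in H$, the point $A_h\in T(H,1)(K)$ is defined by $g(A_h)=\alpha(g,h)$ for all $g\in H$. $Al(H,\alpha)$ is the $K$-algebra with $K$-basis $e(h)$, $h\in H$, and multiplication $e(h)e(h')=\alpha(h,h')e(h+h')$; each $e(h)$ is invertible. $Af(H,\alpha)$ (formal functions on $T(H,\alpha)$) is the $K$-space of all formal infinite linear combinations $\sum_{h\in H}a_he(h)$, $a_h\in K$, a two-sided $Al(H,\alpha)$-module. Analytic functions are introduced in the case of a complete normed field $K$ and unitary $\alpha$ (that is, $|\alpha(g,h)|=1$ for all $g,h\in H$), and the analyticity statement in (b) refers to this notion: a formal function $\sum a_he(h)$ is analytic if, for any $N$, $|a_h|\,\|h\|^N\to0$ as $\|h\|\to\infty$, $\|\cdot\|$ being any Euclidean norm on $H$. The shift by $x\in T(H,1)(K)$ is $x^*\left(\sum a_he(h)\right)=\sum a_h\,h(x)\,e(h)$. $\widetilde{\mathcal G}(H,\alpha)$ is the group of quadruples $[c;x,g,h]$ ($c\in K^*$, $x\in T(H,1)(K)$, $g,h\in H$) with multiplication $$[c';x',g',h']\cdot[c;x,g,h]=[c'c\,g(x')\,h(x')^{-1}\alpha(g',g)\,\alpha(h',h)^{-1};\,xx',\,g+g',\,h+h'],$$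 acting on $Af(H,\alpha)$ by $\Phi\mapsto c\,e(g)\,x^*(\Phi)\,e(h)^{-1}$. Its central subgroup $\widetilde{\mathcal G}_0(H,\alpha)=\{[1;A_h^2,h,h]\mid h\in H\}$ is the kernel of this action, and $\mathcal G(H,\alpha)=\widetilde{\mathcal G}(H,\alpha)/\widetilde{\mathcal G}_0(H,\alpha)$. Every element of $\mathcal G(H,\alpha)$ is the class of a unique element of the form $[c;x,h,0]$, its left representative. A theta multiplier for $T(H,\alpha)$ is a homomorphism $\mathcal L:B\to\mathcal G(H,\alpha)$ with $B$ an abelian group. $\Gamma(\mathcal L)$ is the $K$-linear space of theta functions with multiplier $\mathcal L$, i.e. of formal functions in $Af(H,\alpha)$ invariant under $\mathcal L(B)$. For a multiplier, $b\mapsto h_{l,b}$ and $b\mapsto x_{l,b}$ are homomorphisms and $\langle\cdot,\cdot\rangle$ is a symmetric bimultiplicative pairing $B\times B\to K^*$. "Negative definite" means that the real-valued quadratic form extended to $B\otimes\mathbb R$ is negative definite, and that the form is negative on nonzero elements of $B$. *)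

theory Defs
  imports
    "HOL-Analysis.Analysis"
    "HOL-Algebra.Ring"
    "HOL-Algebra.Coset"
    "HOL-Library.Function_Algebras"
begin

section \<open>Abelian groups as type-class groups\<close>

definition additive_group :: "'a::ab_group_add monoid" where
  "additive_group = \<lparr>carrier = UNIV, monoid.mult = (+), one = 0\<rparr>"

definition zsmul :: "int \<Rightarrow> 'a \<Rightarrow> 'a::ab_group_add" where
  "zsmul n a = a [^]\<^bsub>additive_group\<^esub> n"

definition is_Z_basis :: "'a::ab_group_add set \<Rightarrow> bool" where
  "is_Z_basis S \<longleftrightarrow>
     \<not> Modules.module.dependent zsmul S \<and> Modules.module.span zsmul S = UNIV"

definition free_of_finite_rank :: "'a::ab_group_add itself \<Rightarrow> bool" where
  "free_of_finite_rank _ \<longleftrightarrow> (\<exists>S :: 'a set. finite S \<and> is_Z_basis S)"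

definition rk :: "'a::ab_group_add itself \<Rightarrow> enat" where
  "rk _ = (SUP S \<in> {S :: 'a set. finite S \<and> \<not> Modules.module.dependent zsmul S}. enat (card S))"

definition ecard :: "'a set \<Rightarrow> enat" where
  "ecard A = (if finite A then enat (card A) else \<infinity>)"

definition group_index :: "'a::ab_group_add set \<Rightarrow> enat" where
  "group_index S = ecard (rcosets\<^bsub>additive_group\<^esub> S)"

section \<open>Function spaces\<close>

definition fscale :: "'k::field \<Rightarrow> ('a \<Rightarrow> 'k) \<Rightarrow> 'a \<Rightarrow> 'k" where
  "fscale c f = (\<lambda>a. c * f a)"

definition delta :: "'a \<Rightarrow> 'a \<Rightarrow> 'k::field" where
  "delta a = (\<lambda>b. if b = a then 1 else 0)"

text \<open>The library's \<^term>\<open>vector_space.dim\<close> is 0 on infinite-dimensional spaces; here they get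
  dimension \<open>\<infinity>\<close>.\<close>

definition edim :: "('a \<Rightarrow> 'k::field) set \<Rightarrow> enat" where
  "edim V = (if \<exists>S. finite S \<and> V \<subseteq> Modules.module.span fscale S
             then enat (Vector_Spaces.vector_space.dim fscale V) else \<infinity>)"

section \<open>Definite quadratic forms on abelian groups\<close>

definition polar_form :: "('b::ab_group_add \<Rightarrow> real) \<Rightarrow> 'b \<Rightarrow> 'b \<Rightarrow> real" where
  "polar_form q a b = (q (a + b) - q a - q b) / 2"

definition real_quadratic_form :: "('b::ab_group_add \<Rightarrow> real) \<Rightarrow> bool" where
  "real_quadratic_form q \<longleftrightarrow>
     (\<exists>f. (\<forall>a b. f a b = f b a) \<and> (\<forall>a a' b. f (a + a') b = f a b + f a' b) \<and> (\<forall>b. q b = f b b))"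

text \<open>\<open>B \<otimes> \<real>\<close> is the real vector space of finitely supported functions \<open>r :: B \<Rightarrow> real\<close> (with \<open>r\<close>
  standing for the sum of the \<open>b \<otimes> r b\<close>) modulo the subspace spanned by the relations
  \<open>(a + b) \<otimes> 1 = a \<otimes> 1 + b \<otimes> 1\<close>.\<close>

definition tensor_real_relations :: "('b::ab_group_add \<Rightarrow> real) set" where
  "tensor_real_relations =
     Modules.module.span fscale {delta (a + b) - delta a - delta b | a b. True}"

definition tensor_real_extension :: "('b::ab_group_add \<Rightarrow> real) \<Rightarrow> ('b \<Rightarrow> real) \<Rightarrow> real" where
  "tensor_real_extension q r =
     (\<Sum>a | r a \<noteq> 0. \<Sum>b | r b \<noteq> 0. r a * r b * polar_form q a b)"

definition negative_definite :: "('b::ab_group_add \<Rightarrow> real) \<Rightarrow> bool" where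
  "negative_definite q \<longleftrightarrow> real_quadratic_form q \<and>
     (\<forall>b. b \<noteq> 0 \<longrightarrow> q b < 0) \<and>
     (\<forall>r. finite {b. r b \<noteq> 0} \<and> r \<notin> tensor_real_relations \<longrightarrow> tensor_real_extension q r < 0)"

definition euclidean_norm :: "('h::ab_group_add \<Rightarrow> real) \<Rightarrow> bool" where
  "euclidean_norm E \<longleftrightarrow> (\<exists>q. negative_definite (\<lambda>h. - q h) \<and> E = (\<lambda>h. sqrt (q h)))"

section \<open>Quantum tori\<close>

definition bicharacter :: "('h::ab_group_add \<Rightarrow> 'h \<Rightarrow> 'k::field) \<Rightarrow> bool" where
  "bicharacter \<alpha> \<longleftrightarrow> (\<forall>h g. \<alpha> h g \<noteq> 0) \<and> (\<forall>h g. \<alpha> h g = inverse (\<alpha> g h)) \<and>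
     (\<forall>h1 h2 g. \<alpha> (h1 + h2) g = \<alpha> h1 g * \<alpha> h2 g)"

definition units_group :: "'k::field monoid" where
  "units_group = \<lparr>carrier = {c. c \<noteq> 0}, monoid.mult = (*), one = 1\<rparr>"

text \<open>\<open>T(H,1)(K)\<close>\<close>

definition torus :: "('h::ab_group_add \<Rightarrow> 'k::field) set" where
  "torus = hom additive_group units_group"

text \<open>A formal function \<open>\<Phi> = \<Sum> a\<^sub>h e(h)\<close> is its coefficient family \<open>h \<mapsto> a\<^sub>h\<close>, so that
  \<open>e(h)\<close> is \<^term>\<open>delta h\<close> and \<open>Af(H,\<alpha>)\<close> is the whole type \<open>'h \<Rightarrow> 'k\<close>. The next two operations are
  the products \<open>f \<Phi>\<close> and \<open>\<Phi> f\<close> of a formal function \<open>\<Phi>\<close> with a finite combination \<open>f\<close>.\<close>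

definition lmult :: "('h::ab_group_add \<Rightarrow> 'h \<Rightarrow> 'k::field) \<Rightarrow> ('h \<Rightarrow> 'k) \<Rightarrow> ('h \<Rightarrow> 'k) \<Rightarrow> 'h \<Rightarrow> 'k" where
  "lmult \<alpha> f \<Phi> = (\<lambda>k. \<Sum>g | f g \<noteq> 0. f g * \<Phi> (k - g) * \<alpha> g (k - g))"

definition rmult :: "('h::ab_group_add \<Rightarrow> 'h \<Rightarrow> 'k::field) \<Rightarrow> ('h \<Rightarrow> 'k) \<Rightarrow> ('h \<Rightarrow> 'k) \<Rightarrow> 'h \<Rightarrow> 'k" where
  "rmult \<alpha> \<Phi> f = (\<lambda>k. \<Sum>g | f g \<noteq> 0. \<Phi> (k - g) * f g * \<alpha> (k - g) g)"

definition Al :: "('h::ab_group_add \<Rightarrow> 'h \<Rightarrow> 'k::field) \<Rightarrow> ('h \<Rightarrow> 'k) ring" where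
  "Al \<alpha> = \<lparr>carrier = {f. finite {h. f h \<noteq> 0}}, monoid.mult = lmult \<alpha>, one = delta 0,
           zero = 0, add = (+)\<rparr>"

definition shift :: "('h \<Rightarrow> 'k::field) \<Rightarrow> ('h \<Rightarrow> 'k) \<Rightarrow> 'h \<Rightarrow> 'k" where
  "shift x \<Phi> = (\<lambda>h. \<Phi> h * x h)"

section \<open>Heisenberg groups\<close>

type_synonym ('k, 'h) quadruple = "'k \<times> ('h \<Rightarrow> 'k) \<times> 'h \<times> 'h"

definition heis_tilde :: "('h::ab_group_add \<Rightarrow> 'h \<Rightarrow> 'k::field) \<Rightarrow> ('k, 'h) quadruple monoid" where
  "heis_tilde \<alpha> =
     \<lparr>carrier = {(c, x, g, h). c \<noteq> 0 \<and> x \<in> torus},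
      monoid.mult = (\<lambda>(c', x', g', h') (c, x, g, h).
        (c' * c * x' g * inverse (x' h) * \<alpha> g' g * inverse (\<alpha> h' h),
         (\<lambda>k. x k * x' k), g + g', h + h')),
      one = (1, (\<lambda>k. 1), 0, 0)\<rparr>"

definition heis_tilde_kernel ::
  "('h::ab_group_add \<Rightarrow> 'h \<Rightarrow> 'k::field) \<Rightarrow> ('k, 'h) quadruple set" where
  "heis_tilde_kernel \<alpha> = {(1, (\<lambda>g. (\<alpha> g h)\<^sup>2), h, h) | h. True}"

definition heis :: "('h::ab_group_add \<Rightarrow> 'h \<Rightarrow> 'k::field) \<Rightarrow> ('k, 'h) quadruple set monoid" where
  "heis \<alpha> = heis_tilde \<alpha> Mod heis_tilde_kernel \<alpha>"

fun heis_act :: "('h::ab_group_add \<Rightarrow> 'h \<Rightarrow> 'k::field) \<Rightarrow> ('k, 'h) quadruple \<Rightarrow> ('h \<Rightarrow> 'k) \<Rightarrow> 'h \<Rightarrow> 'k" where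
  "heis_act \<alpha> (c, x, g, h) \<Phi> =
     fscale c (rmult \<alpha> (lmult \<alpha> (delta g) (shift x \<Phi>)) (inv\<^bsub>Al \<alpha>\<^esub> (delta h)))"

text \<open>Every class contains exactly one quadruple of the form \<open>[c; x, h, 0]\<close>.\<close>

definition left_rep :: "('k::field, 'h::ab_group_add) quadruple set \<Rightarrow> 'k \<times> ('h \<Rightarrow> 'k) \<times> 'h" where
  "left_rep X = (THE (c, x, h). (c, x, h, 0) \<in> X)"

section \<open>Theta functions\<close>

definition theta_multiplier ::
  "('h::ab_group_add \<Rightarrow> 'h \<Rightarrow> 'k::field) \<Rightarrow> ('b::ab_group_add \<Rightarrow> ('k, 'h) quadruple set) \<Rightarrow> bool" where
  "theta_multiplier \<alpha> L \<longleftrightarrow> L \<in> hom additive_group (heis \<alpha>)"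

definition c_l :: "('b \<Rightarrow> ('k::field, 'h::ab_group_add) quadruple set) \<Rightarrow> 'b \<Rightarrow> 'k" where
  "c_l L b = fst (left_rep (L b))"

definition x_l :: "('b \<Rightarrow> ('k::field, 'h::ab_group_add) quadruple set) \<Rightarrow> 'b \<Rightarrow> 'h \<Rightarrow> 'k" where
  "x_l L b = fst (snd (left_rep (L b)))"

definition h_l :: "('b \<Rightarrow> ('k::field, 'h::ab_group_add) quadruple set) \<Rightarrow> 'b \<Rightarrow> 'h" where
  "h_l L b = snd (snd (left_rep (L b)))"

text \<open>A class in \<^term>\<open>heis \<alpha>\<close> acts through any of its representatives: the kernel acts trivially.\<close>

definition theta_functions ::
  "('h::ab_group_add \<Rightarrow> 'h \<Rightarrow> 'k::field) \<Rightarrow> ('b \<Rightarrow> ('k, 'h) quadruple set) \<Rightarrow> ('h \<Rightarrow> 'k) set" where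
  "theta_functions \<alpha> L = {\<Phi>. \<forall>b. \<forall>q \<in> L b. heis_act \<alpha> q \<Phi> = \<Phi>}"

definition depends_only_on_h :: "('b \<Rightarrow> ('k::field, 'h::ab_group_add) quadruple set) \<Rightarrow> bool" where
  "depends_only_on_h L \<longleftrightarrow>
     (\<forall>b b'. h_l L b = h_l L b' \<longrightarrow> x_l L b = x_l L b' \<and> c_l L b = c_l L b')"

definition pairing ::
  "('h::ab_group_add \<Rightarrow> 'h \<Rightarrow> 'k::field) \<Rightarrow> ('b \<Rightarrow> ('k, 'h) quadruple set) \<Rightarrow> 'b \<Rightarrow> 'b \<Rightarrow> 'k" where
  "pairing \<alpha> L b1 b2 = x_l L b1 (h_l L b2) * \<alpha> (h_l L b1) (h_l L b2)"

section \<open>Normed fields and analytic functions\<close>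

text \<open>The class \<^class>\<open>real_normed_field\<close> is not usable for the ground field: it is restricted to
  algebras over \<open>\<real>\<close> and excludes, for example, p-adic fields.\<close>

definition field_norm :: "('k::field \<Rightarrow> real) \<Rightarrow> bool" where
  "field_norm \<nu> \<longleftrightarrow> (\<forall>a. 0 \<le> \<nu> a) \<and> (\<forall>a. \<nu> a = 0 \<longleftrightarrow> a = 0) \<and>
     (\<forall>a b. \<nu> (a * b) = \<nu> a * \<nu> b) \<and> (\<forall>a b. \<nu> (a + b) \<le> \<nu> a + \<nu> b)"

definition complete_field_norm :: "('k::field \<Rightarrow> real) \<Rightarrow> bool" where
  "complete_field_norm \<nu> \<longleftrightarrow> field_norm \<nu> \<and> Metric_space.mcomplete UNIV (\<lambda>a b. \<nu> (a - b))"

definition unitary :: "('k::field \<Rightarrow> real) \<Rightarrow> ('h \<Rightarrow> 'h \<Rightarrow> 'k) \<Rightarrow> bool" where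
  "unitary \<nu> \<alpha> \<longleftrightarrow> (\<forall>g h. \<nu> (\<alpha> g h) = 1)"

definition analytic_formal :: "('k::field \<Rightarrow> real) \<Rightarrow> ('h::ab_group_add \<Rightarrow> 'k) \<Rightarrow> bool" where
  "analytic_formal \<nu> \<Phi> \<longleftrightarrow>
     (\<forall>E. euclidean_norm E \<longrightarrow>
        (\<forall>N::nat. ((\<lambda>h. \<nu> (\<Phi> h) * E h ^ N) \<longlongrightarrow> 0) (filtercomap E at_top)))"

text \<open>The topology induced from \<open>(K\<^sup>*)\<^sup>S\<close> through restriction to a basis \<open>S\<close> of \<open>H\<close>.\<close>

definition torus_topology ::
  "('k::field \<Rightarrow> real) \<Rightarrow> 'h::ab_group_add set \<Rightarrow> ('h \<Rightarrow> 'k) topology" where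
  "torus_topology \<nu> S =
     pullback_topology torus (\<lambda>x. restrict x S)
       (product_topology
         (\<lambda>_. subtopology (Metric_space.mtopology UNIV (\<lambda>a b. \<nu> (a - b))) {c. c \<noteq> 0}) S)"

definition discrete_in :: "'a topology \<Rightarrow> 'a set \<Rightarrow> bool" where
  "discrete_in X A \<longleftrightarrow> A \<subseteq> topspace X \<and> subtopology X A = discrete_topology A"

end

theory Submission
  imports Defs "HOL-Real_Asymp.Real_Asymp"
begin

text \<open>
  Write a formal function as its coefficient family \<open>\<Phi> k\<close>. Invariance under the class with left
  representative \<open>[c\<^sub>b; x\<^sub>b, h\<^sub>b, 0]\<close> is the recursion \<open>\<Phi> (k + h\<^sub>b) = m\<^sub>b(k) \<Phi> k\<close> with
  \<open>m\<^sub>b(k) = c\<^sub>b \<alpha>(h\<^sub>b, k) x\<^sub>b(k)\<close>, and multiplicativity of the multiplier makes \<open>m\<close> a cocycle. So a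
  theta function is determined by its values on representatives \<open>r\<close> of the cosets of \<open>h\<^sup>-(B)\<close>, and the
  value at \<open>r\<close> can be prescribed freely if \<open>m\<^sub>b(r) = 1\<close> whenever \<open>h\<^sub>b = 0\<close>, while it must vanish
  otherwise. Hence the dimension is exactly the number of representatives of the first kind
  (\<open>edim_invariants\<close>): at most the index, and equal to it when \<open>m\<^sub>b\<close> depends only on \<open>h\<^sub>b\<close>.

  For part (b) let \<open>q(b) = ln \<bar>\<langle>b, b\<rangle>\<bar>\<close>. If \<open>h\<^sub>b = 0\<close> then \<open>\<langle>b, b\<rangle> = 1\<close>, so \<open>q(b) = 0\<close> and \<open>b = 0\<close>; thus
  \<open>h\<^sup>-\<close> embeds \<open>B\<close> as a sublattice of finite index and the ranks agree. A negative definite form on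
  a lattice satisfies \<open>q(b) \<le> -\<delta> \<parallel>b\<parallel>\<^sup>2\<close> for some \<open>\<delta> > 0\<close>, by compactness of the unit sphere. This is
  where definiteness over the reals, and not only on \<open>B\<close>, enters. Two consequences follow.

  Since \<open>c\<^bsub>a+b\<^esub> = c\<^sub>a c\<^sub>b \<langle>a, b\<rangle>\<close>, the function \<open>ln \<bar>c\<^sub>b\<bar> - q(b)/2\<close> is additive in \<open>b\<close>. The
  recursion then bounds \<open>\<bar>\<Phi> (r + h\<^sub>b)\<bar>\<close> by a constant times \<open>exp (C \<parallel>b\<parallel> - \<delta>/2 \<parallel>b\<parallel>\<^sup>2)\<close>, and this
  Gaussian decay beats every power of the norm of \<open>r + h\<^sub>b\<close>, so \<open>\<Phi>\<close> is analytic.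

  Finally \<open>q(b) = ln \<bar>x\<^sub>b(h\<^sub>b)\<bar>\<close>, because \<open>\<alpha>(h, h) = 1\<close> or \<open>-1\<close>. If \<open>\<bar>x\<^sub>b\<bar>\<close> is close to 1 on a basis, this number
  is at most a small multiple of the length of \<open>h\<^sub>b\<close>, whereas its absolute value grows quadratically
  in that length; so \<open>b = 0\<close>. Therefore the periods are isolated.
\<close>

section \<open>Abelian groups as modules over the integers\<close>

lemma comm_group_additive: "comm_group (additive_group :: 'a::ab_group_add monoid)"
proof (rule comm_groupI)
  fix a :: 'a
  show "\<exists>b\<in>carrier additive_group. b \<otimes>\<^bsub>additive_group\<^esub> a = \<one>\<^bsub>additive_group\<^esub>"
    by (rule bexI[of _ "- a"]) (auto simp: additive_group_def)
qed (auto simp: additive_group_def add_ac)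

lemma module_zsmul: "module (zsmul :: int \<Rightarrow> 'a::ab_group_add \<Rightarrow> 'a)"
proof -
  interpret comm_group "additive_group :: 'a monoid"
    by (rule comm_group_additive)
  have [simp]: "carrier (additive_group :: 'a monoid) = UNIV"
    and mult: "(a :: 'a) \<otimes>\<^bsub>additive_group\<^esub> b = a + b" for a b
    by (auto simp: additive_group_def)
  show ?thesis
    by unfold_locales
      (simp_all add: zsmul_def int_pow_mult int_pow_pow int_pow_distrib mult.commute
        flip: mult)
qed

interpretation Zm: module "zsmul :: int \<Rightarrow> 'a::ab_group_add \<Rightarrow> 'a"
  by (rule module_zsmul)

lemma module_hom_additive:
  assumes "\<And>a b. f (a + b) = f a + f b"
  shows "module_hom zsmul zsmul f"
proof -
  interpret additive f by unfold_locales (rule assms)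
  have nat: "f (zsmul (int n) a) = zsmul (int n) (f a)" for n a
    by (induction n) (simp_all add: zero assms Zm.scale_left_distrib)
  have "f (zsmul n a) = zsmul n (f a)" for n a
  proof (cases "n \<ge> 0")
    case True
    then show ?thesis using nat[of "nat n"] by simp
  next
    case False
    then show ?thesis using nat[of "nat (- n)" a] by (simp add: minus)
  qed
  then show ?thesis by unfold_locales (simp_all add: assms)
qed

lemma additive_zsmul_real:
  fixes f :: "'a::ab_group_add \<Rightarrow> real"
  assumes "\<And>a b. f (a + b) = f a + f b"
  shows "f (zsmul n a) = of_int n * f a"
proof -
  interpret additive f by unfold_locales (rule assms)
  have nat: "f (zsmul (int n) a) = of_nat n * f a" for n a
    by (induction n) (simp_all add: zero assms Zm.scale_left_distrib algebra_simps)
  show ?thesis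
  proof (cases "n \<ge> 0")
    case True
    then show ?thesis using nat[of "nat n"] by simp
  next
    case False
    then show ?thesis using nat[of "nat (- n)" a] by (simp add: minus)
  qed
qed

interpretation Fn: vector_space "fscale :: 'k::field \<Rightarrow> ('a \<Rightarrow> 'k) \<Rightarrow> ('a \<Rightarrow> 'k)"
  by unfold_locales (auto simp: fscale_def fun_eq_iff algebra_simps)

lemma sum_fun_apply: "(\<Sum>a\<in>A. f a) x = (\<Sum>a\<in>A. f a x)"
  by (induction A rule: infinite_finite_induct) simp_all

section \<open>Coset representatives\<close>

lemma rcosets_additive_group:
  "rcosets\<^bsub>additive_group\<^esub> S = range (\<lambda>a. (\<lambda>s. s + a) ` S)"
  by (auto simp: RCOSETS_def r_coset_def additive_group_def)

locale coset_representatives = additive h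
  for h :: "'b::ab_group_add \<Rightarrow> 'h::ab_group_add"
begin

definition coset_rep :: "'h \<Rightarrow> 'h" where
  "coset_rep k = (SOME r. k - r \<in> range h)"

lemma coset_rep_diff: "k - coset_rep k \<in> range h"
  unfolding coset_rep_def by (rule someI[of _ k]) (use zero in \<open>auto intro: rev_image_eqI\<close>)

lemma range_h_diff: "u \<in> range h \<Longrightarrow> v \<in> range h \<Longrightarrow> u - v \<in> range h"
  by (auto simp flip: diff)

lemma range_h_add: "u \<in> range h \<Longrightarrow> v \<in> range h \<Longrightarrow> u + v \<in> range h"
  by (auto simp flip: add)

lemma coset_rep_eq_iff: "coset_rep k = coset_rep k' \<longleftrightarrow> k - k' \<in> range h"
proof
  assume "coset_rep k = coset_rep k'"
  then show "k - k' \<in> range h"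
    using range_h_diff[OF coset_rep_diff[of k] coset_rep_diff[of k']] by simp
next
  assume *: "k - k' \<in> range h"
  have "k - r \<in> range h \<longleftrightarrow> k' - r \<in> range h" for r
    using range_h_diff[OF _ *, of "k - r"] range_h_add[OF _ *, of "k' - r"] by auto
  then show "coset_rep k = coset_rep k'" by (simp add: coset_rep_def)
qed

lemma coset_rep_idem: "r \<in> range coset_rep \<Longrightarrow> coset_rep r = r"
  using coset_rep_diff coset_rep_eq_iff by (metis rangeE)

lemma ecard_coset_reps: "ecard (range coset_rep) = group_index (range h)"
proof -
  let ?C = "\<lambda>r. (\<lambda>s. s + r) ` range h"
  have C_eq: "?C a = ?C b \<longleftrightarrow> a - b \<in> range h" for a b
  proof
    assume "?C a = ?C b"
    moreover have "a \<in> ?C a" using zero by (auto intro!: image_eqI[of _ _ 0] image_eqI[of _ h 0])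
    ultimately have "a \<in> ?C b" by blast
    then show "a - b \<in> range h" by auto
  next
    have "?C a \<subseteq> ?C b" if "a - b \<in> range h" for a b
    proof safe
      fix d
      have "h d + (a - b) \<in> range h" using that by (rule range_h_add[OF rangeI])
      then show "h d + a \<in> ?C b" by (intro image_eqI[of _ _ "h d + (a - b)"]) simp_all
    qed
    moreover assume "a - b \<in> range h"
    moreover from this have "b - a \<in> range h"
      using range_h_diff[of 0 "a - b"] zero by (auto intro: rev_image_eqI)
    ultimately show "?C a = ?C b" by blast
  qed
  have "inj_on ?C (range coset_rep)"
    by (rule inj_onI) (metis C_eq coset_rep_eq_iff coset_rep_idem)
  moreover have "?C ` range coset_rep = range ?C"
  proof -
    have "?C k = ?C (coset_rep k)" for k by (subst C_eq) (rule coset_rep_diff)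
    then show ?thesis by blast
  qed
  ultimately show ?thesis
    unfolding group_index_def ecard_def rcosets_additive_group
    by (metis card_image finite_image_iff)
qed

lemma finite_reps_iff: "finite (range coset_rep) \<longleftrightarrow> group_index (range h) < \<infinity>"
  unfolding ecard_coset_reps[symmetric] by (simp add: ecard_def)

text \<open>Among the \<open>n + 1\<close> multiples \<open>0, k, \<dots>, n k\<close> two lie in the same of the \<open>n\<close> cosets, so some
  \<open>(j - i) k\<close> with \<open>0 < j - i \<le> n\<close> lies in the image. The factorial makes the multiple independent
  of \<open>k\<close>.\<close>

lemma multiple_in_range:
  assumes "finite (range coset_rep)"
  shows "zsmul (fact (card (range coset_rep))) k \<in> range h"
proof -
  let ?n = "card (range coset_rep)"
  interpret h: module_hom zsmul zsmul h by (rule module_hom_additive) (rule add)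
  have "\<not> inj_on (\<lambda>j. coset_rep (zsmul (int j) k)) {..?n}"
  proof
    assume "inj_on (\<lambda>j. coset_rep (zsmul (int j) k)) {..?n}"
    then have "card {..?n} \<le> ?n"
      by (rule card_inj_on_le) (use assms in auto)
    then show False by simp
  qed
  then obtain i j where ij: "i \<le> ?n" "j \<le> ?n" "i < j"
    "coset_rep (zsmul (int i) k) = coset_rep (zsmul (int j) k)"
    unfolding inj_on_def by (metis atMost_iff linorder_neqE_nat)
  then have "zsmul (int j) k - zsmul (int i) k \<in> range h"
    using coset_rep_eq_iff by metis
  then obtain b where b: "zsmul (int j - int i) k = h b"
    by (auto simp: Zm.scale_left_diff_distrib)
  have "j - i dvd fact ?n" using ij by (intro dvd_fact) auto
  then have "int (j - i) dvd fact ?n" by (metis of_nat_dvd_iff of_nat_fact)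
  then obtain u where u: "fact ?n = u * (int j - int i)"
    using \<open>i < j\<close> by (auto simp: dvd_def of_nat_diff mult.commute)
  have "zsmul (fact ?n) k = zsmul u (zsmul (int j - int i) k)"
    by (simp add: u)
  also have "\<dots> = h (zsmul u b)" by (simp add: b h.scale)
  finally show ?thesis by simp
qed

end

section \<open>Functions with a factor of automorphy\<close>

text \<open>The cocycle identity says that \<open>(b, f) \<mapsto> ((k + h b) \<mapsto> m b k * f k)\<close> is an action of \<open>B\<close>;
  the invariants below are its fixed points.\<close>

locale automorphy_factor = coset_representatives h
  for h :: "'b::ab_group_add \<Rightarrow> 'h::ab_group_add" +
  fixes m :: "'b \<Rightarrow> 'h \<Rightarrow> 'k::field"
  assumes m_nonzero: "m b k \<noteq> 0"
    and cocycle: "m (a + b) k = m a (k + h b) * m b k"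
begin

definition invariants :: "('h \<Rightarrow> 'k) set" where
  "invariants = {\<Phi>. \<forall>b k. \<Phi> (k + h b) = m b k * \<Phi> k}"

text \<open>An element of the kernel of \<open>h\<close> fixes \<open>r\<close>, so it multiplies \<open>\<Phi> r\<close> by \<open>m b r\<close>. An invariant
  function can be nonzero at \<open>r\<close> only if all these factors are 1.\<close>

definition admissible_reps :: "'h set" where
  "admissible_reps = {r \<in> range coset_rep. \<forall>b. h b = 0 \<longrightarrow> m b r = 1}"

text \<open>The invariant function that is supported on the coset of \<open>r\<close> and has the value 1 at \<open>r\<close>. On an
  admissible coset the choice of \<open>b\<close> does not matter.\<close>

definition orbit_function :: "'h \<Rightarrow> 'h \<Rightarrow> 'k" where
  "orbit_function r k = (if k - r \<in> range h then m (SOME b. h b = k - r) r else 0)"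

lemma m_0: "m 0 k = 1"
  using cocycle[of 0 0 k] m_nonzero[of 0 k] zero by simp

text \<open>The factor at an admissible point depends on \<open>b\<close> only through \<open>h b\<close>, since two choices differ by
  an element of the kernel.\<close>

lemma m_eq_if_stabilizer_trivial:
  assumes "\<forall>b. h b = 0 \<longrightarrow> m b r = 1" and "h a = h b"
  shows "m a r = m b r"
proof -
  have "h (a - b) = 0" using assms(2) by (simp add: diff)
  then have "m (a - b) r = 1" using assms(1) by blast
  then show ?thesis using cocycle[of b "a - b" r] \<open>h (a - b) = 0\<close> by simp
qed

lemma orbit_function_shift:
  assumes "r \<in> admissible_reps"
  shows "orbit_function r (r + h b) = m b r"
proof -
  have "h (SOME b'. h b' = h b) = h b" by (rule someI) (rule refl)
  then show ?thesis
    using m_eq_if_stabilizer_trivial[of r "SOME b'. h b' = h b" b] assms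
    by (auto simp: orbit_function_def admissible_reps_def)
qed

lemma orbit_function_invariant:
  assumes "r \<in> admissible_reps"
  shows "orbit_function r \<in> invariants"
  unfolding invariants_def
proof safe
  fix b k
  show "orbit_function r (k + h b) = m b k * orbit_function r k"
  proof (cases "k - r \<in> range h")
    case True
    then obtain a where "k - r = h a" by blast
    then have k: "k = r + h a" by (simp add: algebra_simps)
    have "orbit_function r (k + h b) = orbit_function r (r + h (b + a))"
      by (simp add: k add ac_simps)
    then show ?thesis
      using assms by (simp add: orbit_function_shift cocycle k)
  next
    case False
    then have "k + h b - r \<notin> range h"
      using range_h_diff[of "k + h b - r" "h b"] by auto
    with False show ?thesis by (simp add: orbit_function_def)
  qed
qed

lemma orbit_function_at_rep:
  assumes "r \<in> admissible_reps" "r' \<in> range coset_rep"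
  shows "orbit_function r r' = (if r' = r then 1 else 0)"
proof (cases "r' = r")
  case True
  then show ?thesis using orbit_function_shift[OF assms(1), of 0] by (simp add: zero m_0)
next
  case False
  then have "r' - r \<notin> range h"
    using assms coset_rep_eq_iff[of r' r] coset_rep_idem[of r] coset_rep_idem[of r']
    unfolding admissible_reps_def by simp
  with False show ?thesis by (simp add: orbit_function_def)
qed

text \<open>Only the representative of the coset of \<open>k\<close> contributes to the sum at \<open>k\<close>; if it is not
  admissible, then \<open>\<Phi>\<close> vanishes on the whole coset.\<close>

lemma invariant_expansion:
  assumes "\<Phi> \<in> invariants" "finite admissible_reps"
  shows "\<Phi> = (\<Sum>r\<in>admissible_reps. fscale (\<Phi> r) (orbit_function r))"
proof
  fix k
  define r where "r = coset_rep k"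
  have r: "r \<in> range coset_rep" by (simp add: r_def)
  obtain b where "k - r = h b" using coset_rep_diff[of k] unfolding r_def by blast
  then have k: "k = r + h b" by (simp add: algebra_simps)
  have inv: "\<Phi> (k + h b) = m b k * \<Phi> k" for b k
    using assms(1) by (simp add: invariants_def)
  have other: "orbit_function r' k = 0" if "r' \<in> admissible_reps" "r' \<noteq> r" for r'
  proof -
    have "k - r' \<notin> range h"
      using that coset_rep_eq_iff[of k r'] coset_rep_idem[of r']
      unfolding r_def admissible_reps_def by simp
    then show ?thesis by (simp add: orbit_function_def)
  qed
  have "(\<Sum>r'\<in>admissible_reps. \<Phi> r' * orbit_function r' k)
      = (\<Sum>r'\<in>admissible_reps \<inter> {r}. \<Phi> r' * orbit_function r' k)"
    by (rule sum.mono_neutral_right) (use assms(2) other in auto)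
  also have "\<dots> = \<Phi> k"
  proof (cases "r \<in> admissible_reps")
    case True
    then show ?thesis by (simp add: k orbit_function_shift inv mult.commute)
  next
    case False
    then obtain a where "h a = 0" "m a r \<noteq> 1" using r by (auto simp: admissible_reps_def)
    then have "\<Phi> r = 0" using inv[of r a] by simp
    then show ?thesis using False by (simp add: k inv)
  qed
  finally show "\<Phi> k = (\<Sum>r\<in>admissible_reps. fscale (\<Phi> r) (orbit_function r)) k"
    by (simp add: fscale_def sum_fun_apply)
qed

lemma inj_on_orbit_function: "inj_on orbit_function admissible_reps"
proof (rule inj_onI)
  fix r r' assume r: "r \<in> admissible_reps" "r' \<in> admissible_reps" and eq: "orbit_function r = orbit_function r'"
  then have "r' \<in> range coset_rep" by (simp add: admissible_reps_def)
  have "(if r' = r then 1 else 0) = orbit_function r r'"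
    by (rule orbit_function_at_rep[OF r(1) \<open>r' \<in> range coset_rep\<close>, symmetric])
  also have "\<dots> = orbit_function r' r'" by (rule fun_cong[OF eq])
  also have "\<dots> = 1" using orbit_function_at_rep[OF r(2) \<open>r' \<in> range coset_rep\<close>] by simp
  finally show "r = r'" by (simp split: if_splits)
qed

text \<open>Evaluation at the representatives is dual to the family of orbit functions.\<close>

lemma orbit_functions_independent: "Fn.independent (orbit_function ` admissible_reps)"
proof
  assume "Fn.dependent (orbit_function ` admissible_reps)"
  then obtain T u v where T: "finite T" "T \<subseteq> orbit_function ` admissible_reps" "v \<in> T" "u v \<noteq> 0"
    and zero: "(\<Sum>w\<in>T. fscale (u w) w) = 0"
    by (auto simp: Fn.dependent_explicit)
  obtain r where r: "r \<in> admissible_reps" "v = orbit_function r" using T by blast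
  have *: "u w * w r = (if w = v then u w else 0)" if "w \<in> T" for w
  proof -
    obtain r' where r': "r' \<in> admissible_reps" "w = orbit_function r'" using T \<open>w \<in> T\<close> by blast
    have "w = v \<longleftrightarrow> r = r'"
      unfolding r(2) r'(2) using inj_on_eq_iff[OF inj_on_orbit_function r(1) r'(1)] by auto
    moreover have "r \<in> range coset_rep" using r by (simp add: admissible_reps_def)
    ultimately show ?thesis using orbit_function_at_rep[OF r'(1), of r] r'(2) by simp
  qed
  have "(\<Sum>w\<in>T. u w * w r) = (\<Sum>w\<in>T. if w = v then u w else 0)"
    by (intro sum.cong refl *)
  also have "\<dots> = u v" using T by simp
  finally have "u v = (\<Sum>w\<in>T. fscale (u w) w) r" by (simp add: fscale_def sum_fun_apply)
  then show False using T zero by simp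
qed

text \<open>The orbit functions form a basis if there are finitely many of them; if there are infinitely many,
  they are an infinite independent family, which no finite set can span.\<close>

theorem edim_invariants: "edim invariants = ecard admissible_reps"
proof (cases "finite admissible_reps")
  case True
  let ?B = "orbit_function ` admissible_reps"
  have sub: "invariants \<subseteq> Fn.span ?B"
  proof
    fix \<Phi> assume "\<Phi> \<in> invariants"
    then have "\<Phi> = (\<Sum>r\<in>admissible_reps. fscale (\<Phi> r) (orbit_function r))"
      using True by (rule invariant_expansion)
    also have "\<dots> \<in> Fn.span ?B"
      by (intro Fn.span_sum Fn.span_scale Fn.span_base imageI)
    finally show "\<Phi> \<in> Fn.span ?B" .
  qed
  have "Fn.dim invariants = card admissible_reps"
    by (rule Fn.dim_unique[of ?B])
      (use sub orbit_function_invariant orbit_functions_independent card_image[OF inj_on_orbit_function]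
        in auto)
  moreover have "\<exists>S. finite S \<and> invariants \<subseteq> Fn.span S"
    using True sub by (intro exI[of _ ?B]) auto
  ultimately show ?thesis using True by (simp add: edim_def ecard_def)
next
  case False
  have "\<not> (finite S \<and> invariants \<subseteq> Fn.span S)" for S
  proof
    assume S: "finite S \<and> invariants \<subseteq> Fn.span S"
    then have "orbit_function ` admissible_reps \<subseteq> Fn.span S" using orbit_function_invariant by blast
    then have "finite (orbit_function ` admissible_reps)"
      using Fn.independent_span_bound[of S] S orbit_functions_independent by blast
    then show False using False inj_on_orbit_function finite_image_iff by blast
  qed
  then show ?thesis using False by (auto simp: edim_def ecard_def)
qed

lemma ecard_mono: "A \<subseteq> B \<Longrightarrow> ecard A \<le> ecard B"
  by (auto simp: ecard_def card_mono finite_subset)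

corollary edim_invariants_le: "edim invariants \<le> group_index (range h)"
  unfolding edim_invariants ecard_coset_reps[symmetric]
  by (rule ecard_mono) (auto simp: admissible_reps_def)

corollary edim_invariants_eq:
  assumes "\<And>b k. h b = 0 \<Longrightarrow> m b k = 1"
  shows "edim invariants = group_index (range h)"
proof -
  have "admissible_reps = range coset_rep" using assms by (auto simp: admissible_reps_def)
  then show ?thesis by (simp add: edim_invariants ecard_coset_reps)
qed

end

section \<open>The Heisenberg group and its left representatives\<close>

locale bicharacter_group =
  fixes \<alpha> :: "'h::ab_group_add \<Rightarrow> 'h \<Rightarrow> 'k::field"
  assumes bicharacter: "bicharacter \<alpha>"
begin

lemma \<alpha>_nonzero [simp]: "\<alpha> g h \<noteq> 0"
  and \<alpha>_flip: "\<alpha> h g = inverse (\<alpha> g h)"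
  and \<alpha>_add_left: "\<alpha> (h1 + h2) g = \<alpha> h1 g * \<alpha> h2 g"
  using bicharacter unfolding bicharacter_def by blast+

lemma \<alpha>_add_right: "\<alpha> g (h1 + h2) = \<alpha> g h1 * \<alpha> g h2"
  using \<alpha>_flip[of g "h1 + h2"] \<alpha>_flip[of g h1] \<alpha>_flip[of g h2] by (simp add: \<alpha>_add_left)

lemma \<alpha>_0_left [simp]: "\<alpha> 0 g = 1"
  using \<alpha>_add_left[of 0 0 g] by simp

lemma \<alpha>_0_right [simp]: "\<alpha> g 0 = 1"
  using \<alpha>_add_right[of g 0 0] by simp

lemma \<alpha>_minus_left: "\<alpha> (- h) g = inverse (\<alpha> h g)"
  using \<alpha>_add_left[of h "- h" g] by (simp add: field_simps)

lemma \<alpha>_minus_right: "\<alpha> g (- h) = inverse (\<alpha> g h)"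
  using \<alpha>_add_right[of g h "- h"] by (simp add: field_simps)

lemma \<alpha>_diff_left: "\<alpha> (g - h) k = \<alpha> g k * inverse (\<alpha> h k)"
  using \<alpha>_add_left[of g "- h" k] by (simp add: \<alpha>_minus_left)

lemma \<alpha>_diff_right: "\<alpha> k (g - h) = \<alpha> k g * inverse (\<alpha> k h)"
  using \<alpha>_add_right[of k g "- h"] by (simp add: \<alpha>_minus_right)

lemma \<alpha>_diag: "\<alpha> h h * \<alpha> h h = 1"
  using \<alpha>_flip[of h h] by (metis \<alpha>_nonzero right_inverse)

lemma lmult_delta: "lmult \<alpha> (delta g) \<Phi> = (\<lambda>k. \<Phi> (k - g) * \<alpha> g (k - g))"
  by (simp add: lmult_def delta_def)

text \<open>The inverse of \<open>e(h)\<close> is \<open>\<alpha>(h, h) e(-h)\<close>, since \<open>e(h) e(-h) = \<alpha>(h, h)\<^sup>-\<^sup>1 e(0)\<close>.\<close>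

lemma Al_inverse_delta: "inv\<^bsub>Al \<alpha>\<^esub> (delta h) = fscale (\<alpha> h h) (delta (- h))"
  unfolding m_inv_def
proof (rule the_equality)
  let ?y = "fscale (\<alpha> h h) (delta (- h)) :: 'h \<Rightarrow> 'k"
  have supp: "{k. ?y k \<noteq> 0} = {- h}" by (auto simp: fscale_def delta_def)
  have "lmult \<alpha> (delta h) ?y = delta 0"
    unfolding lmult_delta by (auto simp: fscale_def delta_def fun_eq_iff \<alpha>_minus_right)
  moreover have "lmult \<alpha> ?y (delta h) = delta 0"
    unfolding lmult_def supp
    by (auto simp: fscale_def delta_def fun_eq_iff \<alpha>_minus_left)
  ultimately show "?y \<in> carrier (Al \<alpha>) \<and> delta h \<otimes>\<^bsub>Al \<alpha>\<^esub> ?y = \<one>\<^bsub>Al \<alpha>\<^esub>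
      \<and> ?y \<otimes>\<^bsub>Al \<alpha>\<^esub> delta h = \<one>\<^bsub>Al \<alpha>\<^esub>"
    by (simp add: Al_def supp)
next
  fix y
  assume "y \<in> carrier (Al \<alpha>) \<and> delta h \<otimes>\<^bsub>Al \<alpha>\<^esub> y = \<one>\<^bsub>Al \<alpha>\<^esub> \<and> y \<otimes>\<^bsub>Al \<alpha>\<^esub> delta h = \<one>\<^bsub>Al \<alpha>\<^esub>"
  then have "(\<lambda>k. y (k - h) * \<alpha> h (k - h)) = delta 0"
    by (simp add: Al_def lmult_delta)
  from fun_cong[OF this, of "_ + h"] have *: "y k * \<alpha> h k = (if k + h = 0 then 1 else 0)" for k
    by (simp add: delta_def)
  show "y = fscale (\<alpha> h h) (delta (- h))"
  proof
    fix k
    show "y k = fscale (\<alpha> h h) (delta (- h)) k"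
    proof (cases "k = - h")
      case True
      then show ?thesis using *[of k] by (simp add: fscale_def delta_def \<alpha>_minus_right field_simps)
    next
      case False
      then have "k + h \<noteq> 0" by (simp add: eq_neg_iff_add_eq_0)
      then show ?thesis using *[of k] False by (simp add: fscale_def delta_def)
    qed
  qed
qed

text \<open>The factor \<open>\<alpha> h k\<close> collects the scalars that come from multiplication by \<open>e(h)\<^sup>-\<^sup>1\<close> on the right:
  \<open>\<alpha>(h, h) \<alpha>(k + h, -h) = \<alpha>(k, h)\<^sup>-\<^sup>1 = \<alpha>(h, k)\<close>.\<close>

lemma heis_act_eq:
  "heis_act \<alpha> (c, x, g, h) \<Phi>
    = (\<lambda>k. c * \<alpha> h k * \<alpha> g (k + h - g) * x (k + h - g) * \<Phi> (k + h - g))"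
proof
  fix k
  have supp: "{k. fscale (\<alpha> h h) (delta (- h)) k \<noteq> 0} = {- h}" by (auto simp: fscale_def delta_def)
  have "\<alpha> h h * \<alpha> (k + h) (- h) = \<alpha> h k"
    using \<alpha>_flip[of k h] by (simp add: \<alpha>_minus_right \<alpha>_add_left)
  then show "heis_act \<alpha> (c, x, g, h) \<Phi> k
      = c * \<alpha> h k * \<alpha> g (k + h - g) * x (k + h - g) * \<Phi> (k + h - g)"
    unfolding heis_act.simps Al_inverse_delta rmult_def supp lmult_delta
    by (simp add: fscale_def delta_def shift_def mult_ac)
qed

text \<open>The coset of the central subgroup through \<open>[c; x, g, 0]\<close>, parametrized by the last component \<open>j\<close>.
  The scalar \<open>\<alpha> g j\<close> is \<open>\<alpha>(g, j)\<^sup>2 \<alpha>(j, g)\<close>: the first factor is the value of \<open>A\<^sub>j\<^sup>2\<close> at \<open>g\<close>, the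
  second comes from the group law.\<close>

definition left_class :: "'k \<Rightarrow> ('h \<Rightarrow> 'k) \<Rightarrow> 'h \<Rightarrow> ('k, 'h) quadruple set" where
  "left_class c x g = range (\<lambda>j. (c * \<alpha> g j, \<lambda>k. x k * (\<alpha> k j)\<^sup>2, g + j, j))"

lemma torusD:
  assumes "x \<in> torus"
  shows "x (g + h) = x g * x h" "x g \<noteq> 0"
  using assms by (auto simp: torus_def hom_def additive_group_def units_group_def)

lemma torus_0: "x \<in> torus \<Longrightarrow> x 0 = 1"
  using torusD(1)[of x 0 0] torusD(2)[of x 0] by simp

lemma torusI: "(\<And>g h. x (g + h) = x g * x h) \<Longrightarrow> (\<And>g. x g \<noteq> 0) \<Longrightarrow> x \<in> torus"
  by (auto simp: torus_def hom_def additive_group_def units_group_def)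

lemma torus_mult: "x \<in> torus \<Longrightarrow> y \<in> torus \<Longrightarrow> (\<lambda>k. x k * y k) \<in> torus"
  by (rule torusI) (auto simp: torusD)

lemma torus_inverse: "x \<in> torus \<Longrightarrow> (\<lambda>k. inverse (x k)) \<in> torus"
  by (rule torusI) (auto simp: torusD)

lemma torus_\<alpha>: "(\<lambda>k. \<alpha> k h) \<in> torus"
  by (rule torusI) (auto simp: \<alpha>_add_left)

text \<open>Translating the coset parameter of \<open>[c; x, g, h]\<close> by \<open>h\<close> moves the member with last component 0
  to the origin of the parametrization; the constants \<open>c'\<close> and \<open>x'\<close> are those of this member.\<close>

lemma left_class_in_heis:
  assumes "X \<in> carrier (heis \<alpha>)"
  shows "\<exists>c x g. c \<noteq> 0 \<and> x \<in> torus \<and> X = left_class c x g"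
proof -
  from assms obtain c x g h where c: "c \<noteq> 0" and x: "x \<in> torus"
    and X: "X = heis_tilde_kernel \<alpha> #>\<^bsub>heis_tilde \<alpha>\<^esub> (c, x, g, h)"
    by (auto simp: heis_def FactGroup_def RCOSETS_def heis_tilde_def)
  define q where "q = (\<lambda>j. (c * \<alpha> g j ^ 2 * inverse (\<alpha> h j ^ 2) * \<alpha> j g * inverse (\<alpha> j h),
    \<lambda>k. x k * (\<alpha> k j)\<^sup>2, j + g, j + h))"
  define c' where "c' = c * inverse (\<alpha> g h) * \<alpha> h h"
  define x' where "x' = (\<lambda>k. x k * inverse (\<alpha> k h) ^ 2)"
  have "X = range q"
    unfolding X r_coset_def heis_tilde_kernel_def heis_tilde_def q_def by (auto simp: mult_ac)
  also have "q j = (c' * \<alpha> (g - h) (j + h), \<lambda>k. x' k * (\<alpha> k (j + h))\<^sup>2, g - h + (j + h), j + h)" for j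
  proof -
    have "\<alpha> j g = inverse (\<alpha> g j)" "inverse (\<alpha> j h) = \<alpha> h j" "\<alpha> h h = inverse (\<alpha> h h)"
      using \<alpha>_flip[of j g] \<alpha>_flip[of h j] \<alpha>_flip[of h h] by simp_all
    then have "fst (q j) = c' * \<alpha> (g - h) (j + h)"
      using \<alpha>_diag[of h]
      by (simp add: q_def c'_def \<alpha>_diff_left \<alpha>_add_right power2_eq_square field_simps)
    then show ?thesis
      by (simp add: q_def x'_def \<alpha>_add_right power_mult_distrib power_inverse prod_eq_iff fun_eq_iff)
  qed
  then have "range q = (\<lambda>j. (c' * \<alpha> (g - h) j, \<lambda>k. x' k * (\<alpha> k j)\<^sup>2, g - h + j, j)) ` range (\<lambda>j. j + h)"
    unfolding image_image by simp
  also have "range (\<lambda>j. j + h) = UNIV"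
    by (rule surjI[of _ "\<lambda>j. j - h"]) simp
  finally have "X = left_class c' x' (g - h)" by (simp add: left_class_def)
  moreover have "c' \<noteq> 0" using c by (simp add: c'_def)
  moreover have "x' \<in> torus"
    unfolding x'_def power2_eq_square
    by (intro torus_mult torus_inverse torus_\<alpha> x)
  ultimately show ?thesis by blast
qed

lemma mem_left_class: "(c, x, g, 0) \<in> left_class c x g"
  unfolding left_class_def by (rule range_eqI[of _ _ 0]) simp

lemma left_rep_left_class: "left_rep (left_class c x g) = (c, x, g)"
  unfolding left_rep_def
proof (rule the_equality)
  show "case (c, x, g) of (d, y, k) \<Rightarrow> (d, y, k, 0) \<in> left_class c x g"
    by (simp add: mem_left_class)
qed (auto simp: left_class_def)

text \<open>The product of the two left representatives again has last component 0, and a class contains only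
  one such quadruple, so comparing it with the left representative of the product suffices.\<close>

lemma heis_mult_left_class:
  assumes "left_class c' x' g' \<otimes>\<^bsub>heis \<alpha>\<^esub> left_class c x g = left_class d y k"
  shows "d = c' * c * x' g * inverse (x' 0) * \<alpha> g' g" "y = (\<lambda>k. x' k * x k)" "k = g' + g"
proof -
  have "(c', x', g', 0) \<otimes>\<^bsub>heis_tilde \<alpha>\<^esub> (c, x, g, 0) \<in> left_class d y k"
    unfolding assms[symmetric] heis_def FactGroup_def using mem_left_class[of c' x' g'] mem_left_class[of c x g]
    by (auto simp: set_mult_def)
  then have "(c' * c * x' g * inverse (x' 0) * \<alpha> g' g, \<lambda>k. x k * x' k, g' + g, 0) \<in> left_class d y k"
    unfolding heis_tilde_def by (simp add: add.commute)
  then show "d = c' * c * x' g * inverse (x' 0) * \<alpha> g' g" "y = (\<lambda>k. x' k * x k)" "k = g' + g"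
    by (auto simp: left_class_def mult.commute)
qed

text \<open>All members of a class act alike, since the contributions of \<open>j\<close> cancel. This is the triviality
  of the action of the central subgroup.\<close>

lemma heis_act_left_class:
  assumes "q \<in> left_class c x g"
  shows "heis_act \<alpha> q \<Phi> = (\<lambda>k. c * \<alpha> g (k - g) * x (k - g) * \<Phi> (k - g))"
proof -
  obtain j where q: "q = (c * \<alpha> g j, \<lambda>k. x k * (\<alpha> k j)\<^sup>2, g + j, j)"
    using assms by (auto simp: left_class_def)
  have "\<alpha> g j * \<alpha> j k * \<alpha> (g + j) (k - g) * (\<alpha> (k - g) j)\<^sup>2 = \<alpha> g (k - g)" for k
  proof -
    have "\<alpha> j k = inverse (\<alpha> k j)" "\<alpha> j g = inverse (\<alpha> g j)"
      by (rule \<alpha>_flip)+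
    then show ?thesis
      unfolding \<alpha>_add_left \<alpha>_diff_left \<alpha>_diff_right
      by (simp only:) (simp add: power2_eq_square field_simps)
  qed
  note * = this
  have "c * \<alpha> g j * \<alpha> j k * \<alpha> (g + j) (k - g) * (x (k - g) * (\<alpha> (k - g) j)\<^sup>2) * \<Phi> (k - g)
      = (\<alpha> g j * \<alpha> j k * \<alpha> (g + j) (k - g) * (\<alpha> (k - g) j)\<^sup>2) * (c * x (k - g) * \<Phi> (k - g))" for k
    by (simp add: mult_ac)
  also have "\<dots> k = c * \<alpha> g (k - g) * x (k - g) * \<Phi> (k - g)" for k
    by (subst *) (simp add: mult_ac)
  finally have **: "c * \<alpha> g j * \<alpha> j k * \<alpha> (g + j) (k - g) * (x (k - g) * (\<alpha> (k - g) j)\<^sup>2) * \<Phi> (k - g)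
      = c * \<alpha> g (k - g) * x (k - g) * \<Phi> (k - g)" for k .
  have "k + j - (g + j) = k - g" for k by simp
  then show ?thesis
    unfolding q heis_act_eq by (simp only: **)
qed

end

text \<open>The data of a multiplier in terms of left representatives: \<open>x\<close> and \<open>h\<close> are homomorphisms, while
  \<open>c\<close> is one up to the pairing.\<close>

locale theta_multiplier_group = bicharacter_group \<alpha>
  for \<alpha> :: "'h::ab_group_add \<Rightarrow> 'h \<Rightarrow> 'k::field" +
  fixes L :: "'b::ab_group_add \<Rightarrow> ('k, 'h) quadruple set"
  assumes multiplier: "theta_multiplier \<alpha> L"
begin

abbreviation "c \<equiv> c_l L"
abbreviation "x \<equiv> x_l L"
abbreviation "h \<equiv> h_l L"

lemma L_left_class: "L b = left_class (c b) (x b) (h b)"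
  and c_nonzero [simp]: "c b \<noteq> 0"
  and x_torus: "x b \<in> torus"
proof -
  have "L b \<in> carrier (heis \<alpha>)"
    using multiplier by (auto simp: theta_multiplier_def hom_def additive_group_def)
  then obtain d y g where *: "d \<noteq> 0" "y \<in> torus" "L b = left_class d y g"
    using left_class_in_heis by blast
  then have "left_rep (L b) = (d, y, g)" by (simp add: left_rep_left_class)
  with * show "L b = left_class (c b) (x b) (h b)" "c b \<noteq> 0" "x b \<in> torus"
    by (simp_all add: c_l_def x_l_def h_l_def)
qed

lemma x_nonzero [simp]: "x b k \<noteq> 0"
  and x_add_right: "x b (k + l) = x b k * x b l"
  using torusD[OF x_torus] by blast+

lemma c_add: "c (a + b) = c a * c b * pairing \<alpha> L a b"
  and x_add: "x (a + b) k = x a k * x b k"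
  and h_add: "h (a + b) = h a + h b"
proof -
  have "L a \<otimes>\<^bsub>heis \<alpha>\<^esub> L b = L (a + b)"
    using multiplier by (auto simp: theta_multiplier_def hom_def additive_group_def)
  then have "left_class (c a) (x a) (h a) \<otimes>\<^bsub>heis \<alpha>\<^esub> left_class (c b) (x b) (h b)
      = left_class (c (a + b)) (x (a + b)) (h (a + b))"
    by (simp only: L_left_class[symmetric])
  from heis_mult_left_class[OF this]
  show "c (a + b) = c a * c b * pairing \<alpha> L a b" "x (a + b) k = x a k * x b k" "h (a + b) = h a + h b"
    by (simp_all add: pairing_def torus_0[OF x_torus] mult_ac)
qed

definition m :: "'b \<Rightarrow> 'h \<Rightarrow> 'k" where
  "m b k = c b * \<alpha> (h b) k * x b k"

sublocale automorphy_factor h m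
proof unfold_locales
  show "m (a + b) k = m a (k + h b) * m b k" for a b k
    by (simp add: m_def c_add x_add h_add x_add_right \<alpha>_add_left \<alpha>_add_right pairing_def mult_ac)
qed (simp_all add: h_add m_def)

text \<open>With this, the dimension of the space of theta functions is that of the invariants of the factor
  of automorphy \<open>m\<close>.\<close>

lemma theta_functions_eq_invariants: "theta_functions \<alpha> L = invariants"
proof -
  have nonempty: "L b \<noteq> {}" for b using mem_left_class[of "c b" "x b" "h b"] by (metis L_left_class empty_iff)
  have act: "heis_act \<alpha> q \<Phi> = (\<lambda>k. m b (k - h b) * \<Phi> (k - h b))" if "q \<in> L b" for b q \<Phi>
    using heis_act_left_class[of q "c b" "x b" "h b"] that
    by (simp add: m_def flip: L_left_class)
  have "(\<forall>q \<in> L b. heis_act \<alpha> q \<Phi> = \<Phi>) \<longleftrightarrow> (\<lambda>k. m b (k - h b) * \<Phi> (k - h b)) = \<Phi>" for b \<Phi>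
    using nonempty by (simp add: act cong: ball_cong) (metis equals0I surj_pair)
  then have "\<Phi> \<in> theta_functions \<alpha> L \<longleftrightarrow> (\<forall>b. (\<lambda>k. m b (k - h b) * \<Phi> (k - h b)) = \<Phi>)" for \<Phi>
    by (simp add: theta_functions_def)
  moreover have "(\<forall>b. (\<lambda>k. m b (k - h b) * \<Phi> (k - h b)) = \<Phi>) \<longleftrightarrow> \<Phi> \<in> invariants" for \<Phi>
    unfolding invariants_def fun_eq_iff mem_Collect_eq
    by (metis add_diff_cancel diff_add_cancel)
  ultimately show ?thesis by blast
qed

text \<open>If \<open>h b = 0 = h 0\<close>, then the data of \<open>b\<close> are those of \<open>0\<close>.\<close>

lemma m_trivial_on_kernel:
  assumes "depends_only_on_h L" "h b = 0"
  shows "m b k = 1"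
proof -
  have "h b = h 0" using assms(2) by (simp add: zero)
  then have "x b = x 0" "c b = c 0" using assms(1) unfolding depends_only_on_h_def by blast+
  then have "m b k = m 0 k" using \<open>h b = h 0\<close> by (simp only: m_def)
  then show ?thesis by (simp add: m_0)
qed

text \<open>Compare the two expressions for \<open>c (a + b) = c (b + a)\<close>.\<close>

lemma pairing_commute: "pairing \<alpha> L a b = pairing \<alpha> L b a"
  using c_add[of a b] c_add[of b a] by (simp add: add.commute)

lemma pairing_nonzero [simp]: "pairing \<alpha> L a b \<noteq> 0"
  by (simp add: pairing_def)

lemma pairing_add_left: "pairing \<alpha> L (a + a') b = pairing \<alpha> L a b * pairing \<alpha> L a' b"
  by (simp add: pairing_def x_add h_add \<alpha>_add_left)

end

section \<open>Ranks and bases\<close>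

text \<open>A finite generating set involves only finitely many elements of the basis \<open>S\<close>; these already
  generate, and an independent set has no proper generating subset.\<close>

lemma is_Z_basis_finite:
  fixes S :: "'a::ab_group_add set"
  assumes "free_of_finite_rank TYPE('a)" "is_Z_basis S"
  shows "finite S"
proof -
  obtain F :: "'a set" where F: "finite F" "Zm.span F = UNIV"
    using assms(1) by (auto simp: free_of_finite_rank_def is_Z_basis_def)
  have S: "Zm.independent S" "Zm.span S = UNIV"
    using assms(2) by (auto simp: is_Z_basis_def)
  \<comment> \<open>The basis elements that occur in the expansions of the generators.\<close>
  define T where "T = (\<Union>f\<in>F. {s. Zm.representation S f s \<noteq> 0})"
  have T: "T \<subseteq> S" "finite T"
    using F(1) by (auto simp: T_def Zm.finite_representation dest: Zm.representation_ne_zero)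
  have "F \<subseteq> Zm.span T"
  proof
    fix f assume "f \<in> F"
    have "(\<Sum>s | Zm.representation S f s \<noteq> 0. zsmul (Zm.representation S f s) s) \<in> Zm.span T"
      using \<open>f \<in> F\<close> by (intro Zm.span_sum Zm.span_scale Zm.span_base) (auto simp: T_def)
    then show "f \<in> Zm.span T"
      using Zm.sum_nonzero_representation_eq[OF S(1), of f] S(2) by simp
  qed
  then have "Zm.span T = UNIV"
    using F(2) Zm.span_mono[of F "Zm.span T"] by (simp add: Zm.span_span top.extremum_unique)
  then have "S = T"
    using Zm.spanning_subset_independent[OF T(1) S(1)] by auto
  with T show ?thesis by simp
qed

text \<open>Injective homomorphisms preserve independence.\<close>

lemma rk_le_if_inj_additive:
  fixes f :: "'a::ab_group_add \<Rightarrow> 'b::ab_group_add"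
  assumes add: "\<And>a b. f (a + b) = f a + f b" and "inj f"
  shows "rk TYPE('a) \<le> rk TYPE('b)"
  unfolding rk_def
proof (rule SUP_mono)
  interpret f: module_hom zsmul zsmul f by (rule module_hom_additive) (rule add)
  fix S :: "'a set"
  assume S: "S \<in> {S. finite S \<and> Zm.independent S}"
  then have "Zm.independent (f ` S)"
    using \<open>inj f\<close> by (simp add: f.independent_inj_image)
  moreover have "card (f ` S) = card S"
    using \<open>inj f\<close> by (auto intro: card_image inj_on_subset)
  ultimately have "f ` S \<in> {S' :: 'b set. finite S' \<and> Zm.independent S'}" "enat (card S) \<le> enat (card (f ` S))"
    using S by simp_all
  then show "\<exists>S'\<in>{S' :: 'b set. finite S' \<and> Zm.independent S'}. enat (card S) \<le> enat (card S')"
    by blast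
qed

text \<open>A finite subset of an abelian group together with integral coordinates that recover every element
  only after multiplication by \<open>N\<close>, that is, a rational basis with a common denominator. This covers
  a \<open>\<int>\<close>-basis (with \<open>N = 1\<close>) as well as the multiples of a basis of \<open>H\<close> that lie in a subgroup of
  finite index, for which no \<open>\<int>\<close>-basis of the subgroup has to be constructed.\<close>

locale rational_basis =
  fixes T :: "'b::ab_group_add set" and \<phi> :: "'b \<Rightarrow> 'b \<Rightarrow> int" and N :: int
  assumes finite_T: "finite T"
    and N_nonzero: "N \<noteq> 0"
    and \<phi>_add: "t \<in> T \<Longrightarrow> \<phi> t (a + b) = \<phi> t a + \<phi> t b"
    and \<phi>_dual: "s \<in> T \<Longrightarrow> t \<in> T \<Longrightarrow> \<phi> s t = (if s = t then N else 0)"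
    and expansion: "zsmul N b = (\<Sum>t\<in>T. zsmul (\<phi> t b) t)"
begin

text \<open>All estimates use the sum norm of the coordinates, which is subadditive and comparable with every
  Euclidean norm from above.\<close>

definition norm1 :: "'b \<Rightarrow> real" where
  "norm1 b = (\<Sum>t\<in>T. \<bar>of_int (\<phi> t b)\<bar>)"

lemma norm1_nonneg: "0 \<le> norm1 b"
  by (simp add: norm1_def sum_nonneg)

lemma norm1_add: "norm1 (a + b) \<le> norm1 a + norm1 b"
  unfolding norm1_def sum.distrib[symmetric] by (intro sum_mono) (simp add: \<phi>_add)

lemma additive_expansion:
  fixes f :: "'b \<Rightarrow> real"
  assumes "\<And>a b. f (a + b) = f a + f b"
  shows "of_int N * f b = (\<Sum>t\<in>T. of_int (\<phi> t b) * f t)"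
proof -
  interpret additive f by unfold_locales (rule assms)
  have "of_int N * f b = f (zsmul N b)"
    by (rule additive_zsmul_real[symmetric]) (rule assms)
  also have "\<dots> = (\<Sum>t\<in>T. of_int (\<phi> t b) * f t)"
    unfolding expansion sum by (intro sum.cong refl additive_zsmul_real assms)
  finally show ?thesis .
qed

lemma additive_bound:
  fixes f :: "'b \<Rightarrow> real"
  assumes "\<And>a b. f (a + b) = f a + f b"
  obtains C where "\<And>b. \<bar>f b\<bar> \<le> C * norm1 b"
proof
  fix b
  have "\<bar>of_int N * f b\<bar> \<le> (\<Sum>t\<in>T. \<bar>of_int (\<phi> t b)\<bar> * \<bar>f t\<bar>)"
    unfolding additive_expansion[OF assms] by (intro order_trans[OF sum_abs]) (simp add: abs_mult)
  also have "\<dots> \<le> (\<Sum>t\<in>T. norm1 b * \<bar>f t\<bar>)"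
  proof (intro sum_mono mult_right_mono)
    fix t assume "t \<in> T"
    then show "\<bar>of_int (\<phi> t b)\<bar> \<le> norm1 b"
      unfolding norm1_def using finite_T by (intro member_le_sum) auto
  qed simp
  also have "\<dots> = norm1 b * (\<Sum>t\<in>T. \<bar>f t\<bar>)" by (simp add: sum_distrib_left)
  finally show "\<bar>f b\<bar> \<le> (\<Sum>t\<in>T. \<bar>f t\<bar>) / \<bar>of_int N\<bar> * norm1 b"
    using N_nonzero by (simp add: abs_mult field_simps)
qed

end

section \<open>Definite quadratic forms\<close>

text \<open>A negative definite form attains a negative maximum \<open>-\<delta>\<close> on the compact unit sphere of the sum norm,
  and scaling carries the estimate to all vectors. Vectors are functions on the index type, so that
  the sphere sits in a compact product of intervals and points.\<close>

lemma negative_form_bound: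
  fixes M :: "'a \<Rightarrow> 'a \<Rightarrow> real"
  assumes "finite T"
    and neg: "\<And>t. \<exists>s\<in>T. t s \<noteq> 0 \<Longrightarrow> (\<Sum>a\<in>T. \<Sum>b\<in>T. t a * t b * M a b) < 0"
  obtains \<delta> where "\<delta> > 0"
    "\<And>t. (\<Sum>a\<in>T. \<Sum>b\<in>T. t a * t b * M a b) \<le> - \<delta> * (\<Sum>s\<in>T. \<bar>t s\<bar>)\<^sup>2"
proof (cases "T = {}")
  case True
  then show ?thesis by (intro that[of 1]) auto
next
  case False
  define F where "F = (\<lambda>t. \<Sum>a\<in>T. \<Sum>b\<in>T. t a * t b * M a b)"
  define n where "n = (\<lambda>t. \<Sum>s\<in>T. \<bar>t s :: real\<bar>)"
  define Q where "Q = PiE UNIV (\<lambda>s. if s \<in> T then {-1..1::real} else {0})"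
  define K where "K = Q \<inter> {t. n t = 1}"
  have "compactin (product_topology (\<lambda>_. euclidean) UNIV) Q"
    unfolding Q_def by (subst compactin_PiE) auto
  then have "compact Q" by (simp add: euclidean_product_topology)
  moreover have "continuous_on UNIV n"
    unfolding n_def by (intro continuous_intros continuous_on_product_coordinates)
  ultimately have "compact K"
    unfolding K_def by (intro compact_Int_closed closed_Collect_eq continuous_intros) auto
  moreover obtain s0 where s0: "s0 \<in> T" using False by blast
  then have "(\<lambda>s. if s = s0 then 1 else 0) \<in> K"
    using \<open>finite T\<close> by (auto simp: K_def Q_def n_def if_distrib[of abs] cong: if_cong)
  then have "K \<noteq> {}" by blast
  moreover have "continuous_on K F"
    unfolding F_def
    by (intro continuous_intros continuous_on_subset[OF continuous_on_product_coordinates]) auto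
  ultimately obtain t0 where t0: "t0 \<in> K" "\<And>t. t \<in> K \<Longrightarrow> F t \<le> F t0"
    using continuous_attains_sup[of K F] by blast
  have "F t0 < 0"
    unfolding F_def
  proof (rule neg, rule ccontr)
    assume "\<not> (\<exists>s\<in>T. t0 s \<noteq> 0)"
    then have "n t0 = 0" by (simp add: n_def)
    then show False using t0(1) by (simp add: K_def)
  qed
  show ?thesis
  proof (rule that[of "- F t0"])
    show "- F t0 > 0" using \<open>F t0 < 0\<close> by simp
    fix t :: "'a \<Rightarrow> real"
    have "F t \<le> F t0 * (n t)\<^sup>2"
    proof (cases "n t = 0")
      case True
      then have "\<forall>s\<in>T. t s = 0"
        using \<open>finite T\<close> by (auto simp: n_def sum_nonneg_eq_0_iff)
      then show ?thesis using True by (simp add: F_def)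
    next
      case False
      then have "n t > 0" by (metis n_def abs_ge_zero less_eq_real_def sum_nonneg)
      define u where "u = (\<lambda>s. if s \<in> T then t s / n t else 0)"
      have "\<bar>t s\<bar> \<le> n t" if "s \<in> T" for s
        unfolding n_def using that \<open>finite T\<close> by (intro member_le_sum) auto
      then have "u \<in> Q"
        using \<open>n t > 0\<close> by (fastforce simp: Q_def u_def abs_le_iff field_simps)
      moreover have "n u = 1"
      proof -
        have "n u = (\<Sum>s\<in>T. \<bar>t s\<bar> / n t)"
          unfolding n_def[of] by (intro sum.cong) (use \<open>n t > 0\<close> in \<open>auto simp: u_def n_def\<close>)
        also have "\<dots> = 1"
          using \<open>n t > 0\<close> by (simp add: sum_divide_distrib[symmetric] n_def)
        finally show ?thesis .
      qed
      ultimately have "F u \<le> F t0" by (intro t0(2)) (simp add: K_def)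
      moreover have "F u = F t / (n t)\<^sup>2"
        unfolding F_def sum_divide_distrib
        by (intro sum.cong refl) (simp add: u_def power2_eq_square)
      ultimately show ?thesis using \<open>n t > 0\<close> by (simp add: field_simps)
    qed
    then show "(\<Sum>a\<in>T. \<Sum>b\<in>T. t a * t b * M a b) \<le> - (- F t0) * (\<Sum>s\<in>T. \<bar>t s\<bar>)\<^sup>2"
      by (simp add: F_def n_def)
  qed
qed

text \<open>Additive functions on \<open>B\<close> extend to linear functionals on \<open>B \<otimes> \<real>\<close>. They serve to prove that an element
  of the tensor product is nonzero.\<close>

lemma additive_vanishes_on_tensor_relations:
  fixes f :: "'b::ab_group_add \<Rightarrow> real"
  assumes "r \<in> tensor_real_relations" "\<And>a b. f (a + b) = f a + f b"
  shows "finite {b. r b \<noteq> 0} \<and> (\<Sum>b | r b \<noteq> 0. r b * f b) = 0"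
proof -
  have eval: "(\<Sum>b | r b \<noteq> 0. r b * f b) = (\<Sum>b\<in>A. r b * f b)"
    if "finite A" "{b. r b \<noteq> 0} \<subseteq> A" for r :: "'b \<Rightarrow> real" and A
    by (rule sum.mono_neutral_left) (use that in auto)
  let ?V = "{r. finite {b. r b \<noteq> 0} \<and> (\<Sum>b | r b \<noteq> 0. r b * f b) = 0}"
  have "Fn.subspace ?V"
  proof (rule Fn.subspaceI)
    fix r s assume rs: "r \<in> ?V" "s \<in> ?V"
    let ?A = "{b. r b \<noteq> 0} \<union> {b. s b \<noteq> 0}"
    have sub: "{b. (r + s) b \<noteq> 0} \<subseteq> ?A" "{b. r b \<noteq> 0} \<subseteq> ?A" "{b. s b \<noteq> 0} \<subseteq> ?A" by auto
    have fin: "finite ?A" using rs by simp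
    have "(\<Sum>b | (r + s) b \<noteq> 0. (r + s) b * f b)
        = (\<Sum>b | r b \<noteq> 0. r b * f b) + (\<Sum>b | s b \<noteq> 0. s b * f b)"
      unfolding eval[OF fin sub(1)] eval[OF fin sub(2)] eval[OF fin sub(3)]
      by (simp add: sum.distrib[symmetric] algebra_simps)
    then show "r + s \<in> ?V" using rs finite_subset[OF sub(1) fin] by simp
  next
    fix e :: real and r assume r: "r \<in> ?V"
    have sub: "{b. fscale e r b \<noteq> 0} \<subseteq> {b. r b \<noteq> 0}" by (auto simp: fscale_def)
    have fin: "finite {b. r b \<noteq> 0}" using r by simp
    have "(\<Sum>b | fscale e r b \<noteq> 0. fscale e r b * f b) = e * (\<Sum>b | r b \<noteq> 0. r b * f b)"
      unfolding eval[OF fin sub] by (simp add: fscale_def sum_distrib_left mult.assoc)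
    then show "fscale e r \<in> ?V" using r finite_subset[OF sub fin] by simp
  qed simp
  moreover have "{delta (a + b) - delta a - delta b | a b. True} \<subseteq> ?V"
  proof safe
    fix a b
    let ?r = "delta (a + b) - delta a - delta b :: 'b \<Rightarrow> real"
    let ?A = "{a + b, a, b}"
    have sub: "{k. ?r k \<noteq> 0} \<subseteq> ?A" by (auto simp: delta_def)
    then show "finite {k. ?r k \<noteq> 0}" by (rule finite_subset) simp
    have delta: "(\<Sum>k\<in>?A. delta l k * f k) = f l" if "l \<in> ?A" for l
    proof -
      have "(\<Sum>k\<in>?A. delta l k * f k) = (\<Sum>k\<in>?A. if k = l then f k else 0)"
        by (intro sum.cong) (auto simp: delta_def)
      then show ?thesis using that by (subst (asm) sum.delta) auto
    qed
    have "(\<Sum>k | ?r k \<noteq> 0. ?r k * f k) = (\<Sum>k\<in>?A. ?r k * f k)"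
      by (rule eval[OF _ sub]) simp
    also have "\<dots> = f (a + b) - f a - f b"
      by (simp only: minus_apply left_diff_distrib sum_subtractf delta insertI1 insertI2)
    finally show "(\<Sum>k | ?r k \<noteq> 0. ?r k * f k) = 0" by (simp add: assms(2))
  qed
  ultimately show ?thesis
    using assms(1) Fn.span_minimal unfolding tensor_real_relations_def by blast
qed

text \<open>The polar form recovers the symmetric biadditive form that defines \<open>q\<close>.\<close>

lemma polar_form_biadditive:
  assumes "real_quadratic_form q"
  shows "polar_form q a b = polar_form q b a"
    and "polar_form q (a + a') b = polar_form q a b + polar_form q a' b"
    and "polar_form q a a = q a"
proof -
  from assms obtain f where f: "\<And>a b. f a b = f b a" "\<And>a a' b. f (a + a') b = f a b + f a' b"
    "\<And>b. q b = f b b" unfolding real_quadratic_form_def by metis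
  have "f a (b + b') = f a b + f a b'" for a b b'
    using f(1)[of a] f(2) by metis
  then have "polar_form q a b = f a b" for a b
    using f(1)[of a b] by (simp add: polar_form_def f(2,3))
  then show "polar_form q a b = polar_form q b a"
    "polar_form q (a + a') b = polar_form q a b + polar_form q a' b"
    "polar_form q a a = q a"
    using f by simp_all
qed

context rational_basis
begin

lemma quadratic_form_expansion:
  assumes "real_quadratic_form q"
  shows "(of_int N)\<^sup>2 * q b
    = (\<Sum>s\<in>T. \<Sum>t\<in>T. of_int (\<phi> s b) * of_int (\<phi> t b) * polar_form q s t)"
proof -
  note p = polar_form_biadditive[OF assms]
  have p': "polar_form q a (b + b') = polar_form q a b + polar_form q a b'" for a b b'
    using p(1,2) by metis
  have "(of_int N)\<^sup>2 * q b = of_int N * (of_int N * polar_form q b b)"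
    by (simp add: p(3) power2_eq_square)
  also have "\<dots> = of_int N * (\<Sum>s\<in>T. of_int (\<phi> s b) * polar_form q s b)"
    by (subst additive_expansion[where f = "\<lambda>a. polar_form q a b"]) (simp_all add: p(2))
  also have "\<dots> = (\<Sum>s\<in>T. of_int (\<phi> s b) * (of_int N * polar_form q s b))"
    by (simp add: sum_distrib_left mult_ac)
  also have "\<dots> = (\<Sum>s\<in>T. \<Sum>t\<in>T. of_int (\<phi> s b) * of_int (\<phi> t b) * polar_form q s t)"
    by (subst additive_expansion[where f = "polar_form q _"])
      (simp_all add: p' sum_distrib_left mult_ac)
  finally show ?thesis .
qed

lemma quadratic_form_upper_bound:
  assumes "real_quadratic_form q"
  obtains C where "C > 0" "\<And>b. \<bar>q b\<bar> \<le> C * (norm1 b)\<^sup>2"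
proof -
  let ?M = "\<Sum>s\<in>T. \<Sum>t\<in>T. \<bar>polar_form q s t\<bar>"
  have le: "\<bar>of_int (\<phi> t b)\<bar> \<le> norm1 b" if "t \<in> T" for t b
    unfolding norm1_def using finite_T that by (intro member_le_sum) auto
  have "\<bar>q b\<bar> \<le> (?M / (of_int N)\<^sup>2 + 1) * (norm1 b)\<^sup>2" for b
  proof -
    have "(of_int N)\<^sup>2 * \<bar>q b\<bar> = \<bar>(of_int N)\<^sup>2 * q b\<bar>" by (simp add: abs_mult)
    also have "\<dots> \<le> (\<Sum>s\<in>T. \<Sum>t\<in>T. \<bar>of_int (\<phi> s b) * of_int (\<phi> t b) * polar_form q s t\<bar>)"
      unfolding quadratic_form_expansion[OF assms]
      by (intro order_trans[OF sum_abs] sum_mono) simp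
    also have "\<dots> \<le> (\<Sum>s\<in>T. \<Sum>t\<in>T. (norm1 b)\<^sup>2 * \<bar>polar_form q s t\<bar>)"
      unfolding abs_mult power2_eq_square
      by (intro sum_mono mult_right_mono mult_mono le norm1_nonneg) simp_all
    also have "\<dots> = ?M * (norm1 b)\<^sup>2" unfolding sum_distrib_right by (simp add: mult.commute)
    finally have "\<bar>q b\<bar> \<le> ?M / (of_int N)\<^sup>2 * (norm1 b)\<^sup>2"
      using N_nonzero by (simp add: field_simps)
    also have "\<dots> \<le> (?M / (of_int N)\<^sup>2 + 1) * (norm1 b)\<^sup>2"
      by (intro mult_right_mono) simp_all
    finally show ?thesis .
  qed
  moreover have "?M / (of_int N)\<^sup>2 + 1 > 0"
    by (intro add_nonneg_pos divide_nonneg_nonneg sum_nonneg) auto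
  ultimately show ?thesis using that by blast
qed

text \<open>A nonzero real combination of the elements of \<open>T\<close> is a nonzero element of \<open>B \<otimes> \<real>\<close>, because a
  coordinate function detects it. So definiteness on \<open>B \<otimes> \<real>\<close> makes the Gram matrix on \<open>T\<close> negative
  definite, and the bound on the sphere applies.\<close>

lemma negative_definite_bound:
  assumes "negative_definite q"
  obtains \<delta> where "\<delta> > 0" "\<And>b. q b \<le> - \<delta> * (norm1 b)\<^sup>2"
proof -
  have neg: "(\<Sum>a\<in>T. \<Sum>b\<in>T. t a * t b * polar_form q a b) < 0" if nonzero: "\<exists>s\<in>T. t s \<noteq> 0" for t :: "'b \<Rightarrow> real"
  proof -
    obtain s where s: "s \<in> T" "t s \<noteq> 0" using nonzero by blast
    define r where "r = (\<lambda>b. if b \<in> T then t b else 0)"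
    have sub: "{b. r b \<noteq> 0} \<subseteq> T" by (auto simp: r_def)
    have fin: "finite {b. r b \<noteq> 0}" using finite_subset[OF sub finite_T] .
    have "(\<Sum>b | r b \<noteq> 0. r b * of_int (\<phi> s b)) = (\<Sum>b\<in>T. r b * of_int (\<phi> s b))"
      by (rule sum.mono_neutral_left) (use sub finite_T in auto)
    also have "\<dots> = (\<Sum>b\<in>T. if b = s then t b * of_int N else 0)"
      by (intro sum.cong refl) (use s in \<open>auto simp: r_def \<phi>_dual\<close>)
    also have "\<dots> \<noteq> 0" using s finite_T N_nonzero by simp
    finally have "r \<notin> tensor_real_relations"
      using additive_vanishes_on_tensor_relations[of r "\<lambda>b. of_int (\<phi> s b)"] s(1)
      by (auto simp: \<phi>_add)
    then have "tensor_real_extension q r < 0"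
      using assms fin by (auto simp: negative_definite_def)
    also have "tensor_real_extension q r = (\<Sum>a\<in>T. \<Sum>b\<in>T. r a * r b * polar_form q a b)"
      unfolding tensor_real_extension_def
      by (subst sum.mono_neutral_left[OF finite_T sub])
        (auto intro!: sum.cong sum.mono_neutral_left[OF finite_T sub])
    also have "\<dots> = (\<Sum>a\<in>T. \<Sum>b\<in>T. t a * t b * polar_form q a b)"
      by (intro sum.cong refl) (simp add: r_def)
    finally show ?thesis .
  qed
  obtain \<delta> where \<delta>: "\<delta> > 0"
    "\<And>t. (\<Sum>a\<in>T. \<Sum>b\<in>T. t a * t b * polar_form q a b) \<le> - \<delta> * (\<Sum>s\<in>T. \<bar>t s\<bar>)\<^sup>2"
    using negative_form_bound[OF finite_T neg] by blast
  have "q b \<le> - (\<delta> / (of_int N)\<^sup>2) * (norm1 b)\<^sup>2" for b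
  proof -
    have "(of_int N)\<^sup>2 * q b \<le> - \<delta> * (norm1 b)\<^sup>2"
      using \<delta>(2)[of "\<lambda>s. of_int (\<phi> s b)"] assms quadratic_form_expansion[of q b]
      by (simp add: negative_definite_def norm1_def)
    then show ?thesis using N_nonzero by (simp add: field_simps)
  qed
  then show ?thesis using that[of "\<delta> / (of_int N)\<^sup>2"] \<delta>(1) N_nonzero by simp
qed

end

section \<open>Subgroups of finite index in a lattice\<close>

locale lattice_basis =
  fixes S :: "'h::ab_group_add set"
  assumes basis: "is_Z_basis S" and finite_basis: "finite S"
begin

abbreviation coord :: "'h \<Rightarrow> 'h \<Rightarrow> int" where
  "coord s k \<equiv> Zm.representation S k s"

lemma independent: "Zm.independent S" and span: "k \<in> Zm.span S"
  using basis by (auto simp: is_Z_basis_def)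

sublocale lattice: rational_basis S coord 1
proof
  fix b
  show "zsmul 1 b = (\<Sum>s\<in>S. zsmul (coord s b) s)"
    using Zm.sum_representation_eq[OF independent span finite_basis order_refl] by simp
qed (use independent span finite_basis in
  \<open>simp_all add: Zm.representation_add Zm.representation_basis\<close>)

lemma coord_zsmul: "coord s (zsmul n k) = n * coord s k"
  using Zm.representation_scale[OF independent span] by simp

lemma coord_basis: "s' \<in> S \<Longrightarrow> coord s s' = (if s = s' then 1 else 0)"
  using Zm.representation_basis[OF independent] by simp

lemma norm1_eq_0_iff: "lattice.norm1 k = 0 \<longleftrightarrow> k = 0"
proof
  assume "lattice.norm1 k = 0"
  then have "\<forall>s\<in>S. coord s k = 0"
    using finite_basis by (simp add: lattice.norm1_def sum_nonneg_eq_0_iff)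
  then have "(\<Sum>s\<in>S. zsmul (coord s k) s) = 0" by simp
  then show "k = 0" using lattice.expansion[of k] by simp
next
  assume "k = 0"
  then show "lattice.norm1 k = 0" by (simp add: lattice.norm1_def Zm.representation_zero)
qed

text \<open>Coordinates are integers, so the lattice has no nonzero vectors of norm below 1. This gap is what
  turns the growth estimates into discreteness.\<close>

lemma norm1_ge_1:
  assumes "k \<noteq> 0"
  shows "1 \<le> lattice.norm1 k"
proof -
  have eq: "lattice.norm1 k = of_int (\<Sum>s\<in>S. \<bar>coord s k\<bar>)" by (simp add: lattice.norm1_def)
  have "lattice.norm1 k > 0"
    using norm1_eq_0_iff[of k] lattice.norm1_nonneg[of k] assms by linarith
  then have "0 < (\<Sum>s\<in>S. \<bar>coord s k\<bar>)" unfolding eq by linarith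
  then show ?thesis unfolding eq by linarith
qed

lemma zsmul_eq_0:
  assumes "n \<noteq> 0" "zsmul n k = (0 :: 'h)"
  shows "k = 0"
proof -
  have "lattice.norm1 k = 0"
    using coord_zsmul[where n = n and k = k] assms by (simp add: lattice.norm1_def Zm.representation_zero)
  then show "k = 0" by (simp add: norm1_eq_0_iff)
qed

end

text \<open>An embedding \<open>h\<close> of finite index. Multiplication by a suitable integer maps \<open>H\<close> into the image of
  \<open>h\<close> and so yields an embedding \<open>lift\<close> in the other direction; it transports a basis of \<open>H\<close> to a
  rational basis of \<open>B\<close> and gives the equality of ranks.\<close>

locale finite_index_sublattice = coset_representatives h + lattice_basis S
  for h :: "'b::ab_group_add \<Rightarrow> 'h::ab_group_add" and S :: "'h set" +
  assumes inj: "inj h" and finite_reps: "finite (range coset_rep)"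
begin

definition index_multiple :: int where
  "index_multiple = fact (card (range coset_rep))"

definition lift :: "'h \<Rightarrow> 'b" where
  "lift k = inv_into UNIV h (zsmul index_multiple k)"

lemma index_multiple_nonzero: "index_multiple \<noteq> 0"
  by (simp add: index_multiple_def)

lemma h_lift: "h (lift k) = zsmul index_multiple k"
  unfolding lift_def index_multiple_def using multiple_in_range[OF finite_reps] by (rule f_inv_into_f)

lemma lift_add: "lift (k + l) = lift k + lift l"
  by (rule injD[OF inj]) (simp add: h_lift add Zm.scale_right_distrib)

lemma inj_lift: "inj lift"
proof (rule injI)
  fix k l assume "lift k = lift l"
  then have "zsmul index_multiple (k - l) = 0"
    using h_lift[of k] h_lift[of l] by (simp add: Zm.scale_right_diff_distrib)
  then show "k = l" using zsmul_eq_0[OF index_multiple_nonzero, of "k - l"] by simp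
qed

lemma rk_eq: "rk TYPE('b) = rk TYPE('h)"
  by (rule antisym; rule rk_le_if_inj_additive) (fact add inj lift_add inj_lift)+

abbreviation lift_coord :: "'b \<Rightarrow> 'b \<Rightarrow> int" where
  "lift_coord t b \<equiv> coord (inv_into UNIV lift t) (h b)"

sublocale sub: rational_basis "lift ` S" lift_coord index_multiple
proof
  interpret h: module_hom zsmul zsmul h by (rule module_hom_additive) (rule add)
  fix b
  show "zsmul index_multiple b = (\<Sum>t\<in>lift ` S. zsmul (lift_coord t b) t)"
  proof (rule injD[OF inj])
    have "h (\<Sum>t\<in>lift ` S. zsmul (lift_coord t b) t)
        = (\<Sum>s\<in>S. zsmul (coord s (h b)) (zsmul index_multiple s))"
      by (simp add: h.sum h.scale h_lift sum.reindex inj_on_subset[OF inj_lift] inv_f_f[OF inj_lift])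
    also have "\<dots> = zsmul index_multiple (\<Sum>s\<in>S. zsmul (coord s (h b)) s)"
      by (simp add: Zm.scale_sum_right mult.commute)
    also have "\<dots> = h (zsmul index_multiple b)"
      using lattice.expansion[of "h b"] by (simp add: h.scale)
    finally show "h (zsmul index_multiple b) = h (\<Sum>t\<in>lift ` S. zsmul (lift_coord t b) t)" ..
  qed
next
  fix t t' assume "t \<in> lift ` S" "t' \<in> lift ` S"
  then show "lift_coord t t' = (if t = t' then index_multiple else 0)"
    by (auto simp: h_lift coord_zsmul coord_basis inv_f_f[OF inj_lift] inj_eq[OF inj_lift])
qed (use finite_basis index_multiple_nonzero in \<open>auto simp: add lattice.\<phi>_add inv_f_f[OF inj_lift]\<close>)

lemma sub_norm1: "sub.norm1 b = lattice.norm1 (h b)"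
  unfolding sub.norm1_def lattice.norm1_def
  by (simp add: sum.reindex inj_on_subset[OF inj_lift] inv_f_f[OF inj_lift])

end

section \<open>Norms on fields\<close>

locale normed_field =
  fixes \<nu> :: "'k::field \<Rightarrow> real"
  assumes norm: "field_norm \<nu>"
begin

lemma \<nu>_nonneg: "0 \<le> \<nu> a"
  and \<nu>_eq_0 [simp]: "\<nu> a = 0 \<longleftrightarrow> a = 0"
  and \<nu>_mult: "\<nu> (a * b) = \<nu> a * \<nu> b"
  and \<nu>_triangle: "\<nu> (a + b) \<le> \<nu> a + \<nu> b"
  using norm by (auto simp: field_norm_def)

lemma \<nu>_pos: "a \<noteq> 0 \<Longrightarrow> 0 < \<nu> a"
  using \<nu>_nonneg[of a] by (simp add: order_less_le)

lemma \<nu>_eq_1_if_square: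
  assumes "a * a = 1"
  shows "\<nu> a = 1"
proof -
  have "\<nu> 1 = 1" using \<nu>_mult[of 1 1] by simp
  then have "(\<nu> a)\<^sup>2 = 1\<^sup>2" using \<nu>_mult[of a a] assms by (simp add: power2_eq_square)
  then show ?thesis using \<nu>_nonneg[of a] by (metis power2_eq_imp_eq zero_le_one)
qed

lemma \<nu>_minus: "\<nu> (- a) = \<nu> a"
  using \<nu>_mult[of "-1" a] \<nu>_eq_1_if_square[of "-1"] by simp

lemma ln_\<nu>_mult: "a \<noteq> 0 \<Longrightarrow> b \<noteq> 0 \<Longrightarrow> ln (\<nu> (a * b)) = ln (\<nu> a) + ln (\<nu> b)"
  by (simp add: \<nu>_mult ln_mult \<nu>_pos)

lemma Metric_space: "Metric_space UNIV (\<lambda>a b. \<nu> (a - b))"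
proof
  fix a b c :: 'k
  show "\<nu> (a - b) = \<nu> (b - a)" using \<nu>_minus[of "a - b"] by simp
  show "\<nu> (a - c) \<le> \<nu> (a - b) + \<nu> (b - c)" using \<nu>_triangle[of "a - b" "b - c"] by simp
qed (simp_all add: \<nu>_nonneg)

text \<open>The norm is continuous, by the reverse triangle inequality. Annuli suffice to separate periods,
  because the norms of their values already distinguish periods.\<close>

lemma openin_annulus:
  "openin (Metric_space.mtopology UNIV (\<lambda>a b. \<nu> (a - b))) {a. l < \<nu> a \<and> \<nu> a < u}"
proof -
  interpret Metric_space UNIV "\<lambda>a b. \<nu> (a - b)" by (rule Metric_space)
  have diff: "\<nu> a - \<nu> b \<le> \<nu> (a - b)" for a b
    using \<nu>_triangle[of "a - b" b] by simp
  show ?thesis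
    unfolding openin_mtopology
  proof safe
    fix a assume a: "l < \<nu> a" "\<nu> a < u"
    have "mball a (min (\<nu> a - l) (u - \<nu> a)) \<subseteq> {a. l < \<nu> a \<and> \<nu> a < u}"
    proof
      fix b assume "b \<in> mball a (min (\<nu> a - l) (u - \<nu> a))"
      then show "b \<in> {a. l < \<nu> a \<and> \<nu> a < u}"
        using diff[of a b] diff[of b a] commute[of a b] by simp
    qed
    then show "\<exists>r>0. mball a r \<subseteq> {a. l < \<nu> a \<and> \<nu> a < u}"
      using a by (intro exI[of _ "min (\<nu> a - l) (u - \<nu> a)"]) simp
  qed simp
qed

end

section \<open>Ample multipliers\<close>

text \<open>All estimates are made in the coordinates of the basis \<open>S\<close>. It is a parameter of the locale because
  the periods have to be discrete for the topology that comes from an arbitrary basis.\<close>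

locale ample_multiplier =
  theta_multiplier_group \<alpha> L + lattice_basis S + normed_field \<nu>
  for \<alpha> :: "'h::ab_group_add \<Rightarrow> 'h \<Rightarrow> 'k::field" and L :: "'b::ab_group_add \<Rightarrow> ('k, 'h) quadruple set"
    and S :: "'h set" and \<nu> :: "'k \<Rightarrow> real" +
  assumes finite_index: "group_index (range h) < \<infinity>"
    and negative: "negative_definite (\<lambda>b. ln (\<nu> (pairing \<alpha> L b b)))"
begin

definition q :: "'b \<Rightarrow> real" where
  "q b = ln (\<nu> (pairing \<alpha> L b b))"

lemma negative_definite_q: "negative_definite q"
  using negative by (simp add: q_def[abs_def])

lemma \<nu>_\<alpha>_diag: "\<nu> (\<alpha> k k) = 1"
  by (rule \<nu>_eq_1_if_square) (rule \<alpha>_diag)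

lemma q_eq: "q b = ln (\<nu> (x b (h b)))"
  by (simp add: q_def pairing_def \<nu>_mult \<nu>_\<alpha>_diag)

text \<open>On the kernel of \<open>h\<close> the pairing is trivial, and a definite form has no nonzero zeros.\<close>

lemma inj_h: "inj h"
proof (rule injI)
  fix a b assume "h a = h b"
  then have "h (a - b) = 0" by (simp add: diff)
  then have "q (a - b) = 0"
    using \<nu>_eq_1_if_square[of 1] torus_0[OF x_torus] by (simp add: q_eq)
  then show "a = b"
    using negative_definite_q unfolding negative_definite_def
    by (metis less_irrefl right_minus_eq)
qed

sublocale finite_index_sublattice h S
  by unfold_locales (use inj_h finite_index finite_reps_iff in auto)

lemma ln_\<nu>_x_add: "ln (\<nu> (x b (k + l))) = ln (\<nu> (x b k)) + ln (\<nu> (x b l))"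
  by (simp add: x_add_right ln_\<nu>_mult)

lemma ln_\<nu>_x_add_left: "ln (\<nu> (x (a + b) k)) = ln (\<nu> (x a k)) + ln (\<nu> (x b k))"
  by (simp add: x_add ln_\<nu>_mult)

text \<open>The number \<open>q b = ln \<bar>x\<^sub>b(h\<^sub>b)\<bar>\<close> is a linear expression in the coordinates of \<open>h\<^sub>b\<close> with the small
  coefficients \<open>ln \<bar>x\<^sub>b(s)\<bar>\<close>, but it is at most \<open>-\<delta> \<parallel>h\<^sub>b\<parallel>\<^sup>2\<close>. With \<open>\<epsilon> = \<delta>/2\<close> this forces \<open>\<parallel>h\<^sub>b\<parallel> \<le> 1/2\<close>.\<close>

lemma period_lattice_isolated:
  obtains \<epsilon> where "\<epsilon> > 0" "\<And>b. \<forall>s\<in>S. \<bar>ln (\<nu> (x b s))\<bar> < \<epsilon> \<Longrightarrow> b = 0"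
proof -
  obtain \<delta> where \<delta>: "\<delta> > 0" "\<And>b. q b \<le> - \<delta> * (sub.norm1 b)\<^sup>2"
    using sub.negative_definite_bound[OF negative_definite_q] by blast
  have "b = 0" if small: "\<forall>s\<in>S. \<bar>ln (\<nu> (x b s))\<bar> < \<delta> / 2" for b
  proof (rule ccontr)
    assume "b \<noteq> 0"
    then have "h b \<noteq> 0" using injD[OF inj_h, of b 0] by (auto simp: zero)
    let ?n = "lattice.norm1 (h b)"
    have "1 \<le> ?n" by (rule norm1_ge_1) fact
    have "q b = (\<Sum>s\<in>S. of_int (coord s (h b)) * ln (\<nu> (x b s)))"
      unfolding q_eq using lattice.additive_expansion[of "\<lambda>k. ln (\<nu> (x b k))" "h b"]
      by (simp only: ln_\<nu>_x_add of_int_1 mult_1)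
    then have "\<bar>q b\<bar> \<le> (\<Sum>s\<in>S. \<bar>of_int (coord s (h b)) * ln (\<nu> (x b s))\<bar>)"
      using sum_abs by metis
    also have "\<dots> = (\<Sum>s\<in>S. \<bar>of_int (coord s (h b))\<bar> * \<bar>ln (\<nu> (x b s))\<bar>)"
      by (simp only: abs_mult)
    also have "\<dots> \<le> (\<Sum>s\<in>S. \<bar>of_int (coord s (h b))\<bar> * (\<delta> / 2))"
      using small by (intro sum_mono mult_left_mono) auto
    also have "\<dots> = \<delta> / 2 * ?n"
      by (simp add: lattice.norm1_def sum_distrib_left mult.commute)
    finally have "\<delta> * ?n\<^sup>2 \<le> \<delta> / 2 * ?n" using \<delta>(2)[of b] by (simp add: sub_norm1)
    then have "?n * ?n \<le> ?n / 2" using \<delta>(1) by (simp add: power2_eq_square field_simps)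
    moreover have "1 * ?n \<le> ?n * ?n" using \<open>1 \<le> ?n\<close> by (intro mult_right_mono) auto
    ultimately show False using \<open>1 \<le> ?n\<close> by simp
  qed
  then show ?thesis using that[of "\<delta> / 2"] \<delta>(1) by simp
qed

text \<open>The box of points whose values on \<open>S\<close> differ from those of \<open>x b\<close> by factors of norm between
  \<open>exp (-\<epsilon>)\<close> and \<open>exp \<epsilon>\<close> is open, and the isolation of the trivial period, applied to a difference
  \<open>a - b\<close>, shows that it contains no other period.\<close>

lemma period_lattice_discrete: "discrete_in (torus_topology \<nu> S) (range x)"
proof -
  let ?X = "torus_topology \<nu> S"
  let ?K = "subtopology (Metric_space.mtopology UNIV (\<lambda>a b. \<nu> (a - b))) {c. c \<noteq> 0}"
  have topspace_K: "topspace ?K = {c. c \<noteq> 0}"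
    using Metric_space.topspace_mtopology[OF Metric_space] by simp
  have sub: "range x \<subseteq> topspace ?X"
    unfolding torus_topology_def topspace_pullback_topology topspace_product_topology topspace_K
    using x_torus by (auto simp: PiE_def)
  obtain \<epsilon> where \<epsilon>: "\<epsilon> > 0" "\<And>b. \<forall>s\<in>S. \<bar>ln (\<nu> (x b s))\<bar> < \<epsilon> \<Longrightarrow> b = 0"
    using period_lattice_isolated by blast
  have "openin (subtopology ?X (range x)) {x b}" for b
  proof -
    define A where "A = (\<lambda>s. {a. exp (- \<epsilon>) * \<nu> (x b s) < \<nu> a \<and> \<nu> a < exp \<epsilon> * \<nu> (x b s)})"
    have A_nonzero: "A s \<subseteq> {c. c \<noteq> 0}" for s
    proof
      fix a assume "a \<in> A s"
      then have "0 < \<nu> a"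
        unfolding A_def using \<nu>_pos[OF x_nonzero, of b s]
        by (auto intro: less_trans[rotated])
      then show "a \<in> {c. c \<noteq> 0}" by (metis \<nu>_eq_0 less_irrefl mem_Collect_eq)
    qed
    have "openin ?K (A s)" for s
      using openin_annulus A_nonzero[of s] unfolding A_def
      by (auto simp: openin_subtopology)
    then have "openin (product_topology (\<lambda>_. ?K) S) (PiE S A)"
      using finite_basis by (simp add: openin_PiE_gen)
    then have open_box: "openin ?X ((\<lambda>y. restrict y S) -` PiE S A \<inter> torus)"
      unfolding torus_topology_def openin_pullback_topology by blast
    have "restrict (x b) S \<in> PiE S A"
      using \<epsilon>(1) \<nu>_pos[OF x_nonzero] by (auto simp: A_def)
    moreover have "x a = x b" if a: "restrict (x a) S \<in> PiE S A" for a
    proof -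
      have "a - b = 0"
      proof (rule \<epsilon>(2), rule ballI)
        fix s assume "s \<in> S"
        then have "x a s \<in> A s" using PiE_mem[OF a, of s] by simp
        then have "ln (exp (- \<epsilon>) * \<nu> (x b s)) < ln (\<nu> (x a s))"
          "ln (\<nu> (x a s)) < ln (exp \<epsilon> * \<nu> (x b s))"
          unfolding A_def using \<nu>_pos[OF x_nonzero] by simp_all
        then show "\<bar>ln (\<nu> (x (a - b) s))\<bar> < \<epsilon>"
          using ln_\<nu>_x_add_left[of "a - b" b s] \<nu>_pos[OF x_nonzero, of b s]
          by (simp add: ln_mult)
      qed
      then show ?thesis by simp
    qed
    ultimately have "{x b} = ((\<lambda>y. restrict y S) -` PiE S A \<inter> torus) \<inter> range x"
      using x_torus by blast
    with open_box show ?thesis unfolding openin_subtopology by blast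
  qed
  then have "subtopology ?X (range x) = discrete_topology (range x)"
    using sub discrete_topology_unique[of "range x" "subtopology ?X (range x)"]
    by (simp add: inf_absorb2)
  with sub show ?thesis by (simp add: discrete_in_def)
qed

end

section \<open>Analyticity of theta functions\<close>

lemma gaussian_decay:
  fixes a C d D z :: real
  assumes "d > 0" "D > 0"
  shows "((\<lambda>s. a * exp (C * s - d * s\<^sup>2) * (D * (z + s)) ^ N) \<longlongrightarrow> 0) at_top"
  using assms by real_asymp

context ample_multiplier
begin

lemma q_add: "q (a + b) = q a + q b + 2 * ln (\<nu> (pairing \<alpha> L a b))"
proof -
  have "pairing \<alpha> L (a + b) (a + b)
      = pairing \<alpha> L a a * pairing \<alpha> L b b * (pairing \<alpha> L a b * pairing \<alpha> L a b)"
    using pairing_commute[of a "a + b"] pairing_commute[of b "a + b"] pairing_commute[of a b]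
    by (simp add: pairing_add_left mult_ac)
  then show ?thesis by (simp add: q_def ln_\<nu>_mult)
qed

text \<open>By the law for \<open>c (a + b)\<close>, the function \<open>ln \<bar>c\<^sub>b\<bar>\<close> has the same polarization as \<open>q b / 2\<close>. So the
  scalars of the multiplier decay like a Gaussian up to an exponential.\<close>

lemma ln_\<nu>_c_additive: "ln (\<nu> (c (a + b))) - q (a + b) / 2
    = (ln (\<nu> (c a)) - q a / 2) + (ln (\<nu> (c b)) - q b / 2)"
  by (simp add: c_add ln_\<nu>_mult q_add field_simps)

text \<open>Along one coset, \<open>ln \<bar>m\<^sub>b(r)\<bar>\<close> is \<open>q b / 2\<close> plus an additive function of \<open>b\<close>, and additive
  functions grow at most linearly.\<close>

lemma theta_coefficient_bound:
  assumes "\<Phi> \<in> theta_functions \<alpha> L"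
  obtains C \<delta> where "\<delta> > 0"
    "\<And>b. \<nu> (\<Phi> (r + h b)) \<le> \<nu> (\<Phi> r) * exp (C * sub.norm1 b - \<delta> * (sub.norm1 b)\<^sup>2)"
proof -
  obtain \<delta> where \<delta>: "\<delta> > 0" "\<And>b. q b \<le> - \<delta> * (sub.norm1 b)\<^sup>2"
    using sub.negative_definite_bound[OF negative_definite_q] by blast
  define l where "l = (\<lambda>b. (ln (\<nu> (c b)) - q b / 2) + ln (\<nu> (\<alpha> (h b) r)) + ln (\<nu> (x b r)))"
  have "ln (\<nu> (\<alpha> (h (a + b)) r)) = ln (\<nu> (\<alpha> (h a) r)) + ln (\<nu> (\<alpha> (h b) r))" for a b
    by (simp add: h_add \<alpha>_add_left ln_\<nu>_mult)
  then have "l (a + b) = l a + l b" for a b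
    unfolding l_def by (simp only: ln_\<nu>_c_additive ln_\<nu>_x_add_left add_ac)
  then obtain C where C: "\<And>b. \<bar>l b\<bar> \<le> C * sub.norm1 b"
    using sub.additive_bound[of l] by blast
  have "\<nu> (\<Phi> (r + h b)) \<le> \<nu> (\<Phi> r) * exp (C * sub.norm1 b - \<delta> / 2 * (sub.norm1 b)\<^sup>2)" for b
  proof -
    have "\<nu> (m b r) = exp (ln (\<nu> (c b)) + ln (\<nu> (\<alpha> (h b) r)) + ln (\<nu> (x b r)))"
      by (simp add: m_def \<nu>_mult exp_add \<nu>_pos)
    also have "ln (\<nu> (c b)) + ln (\<nu> (\<alpha> (h b) r)) + ln (\<nu> (x b r)) = l b + q b / 2"
      by (simp add: l_def)
    also have "exp (l b + q b / 2) \<le> exp (C * sub.norm1 b - \<delta> / 2 * (sub.norm1 b)\<^sup>2)"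
      using C[of b] \<delta>(2)[of b] by simp
    finally have "\<nu> (m b r) * \<nu> (\<Phi> r) \<le> exp (C * sub.norm1 b - \<delta> / 2 * (sub.norm1 b)\<^sup>2) * \<nu> (\<Phi> r)"
      by (rule mult_right_mono) (rule \<nu>_nonneg)
    moreover have "\<Phi> (r + h b) = m b r * \<Phi> r"
      using assms by (simp add: theta_functions_eq_invariants invariants_def)
    ultimately show ?thesis by (simp add: \<nu>_mult mult.commute)
  qed
  then show ?thesis using that[of "\<delta> / 2" C] \<delta>(1) by simp
qed

text \<open>Every Euclidean norm is dominated by the sum norm, so that decay in terms of the latter implies
  decay in terms of the former.\<close>

lemma euclidean_norm_bound:
  assumes "euclidean_norm E"
  obtains D where "D > 0" "\<And>k. E k \<le> D * lattice.norm1 k" "\<And>k. 0 \<le> E k"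
proof -
  obtain p where p: "negative_definite (\<lambda>k :: 'h. - p k)" "E = (\<lambda>k. sqrt (p k))"
    using assms by (auto simp: euclidean_norm_def)
  obtain C where C: "C > 0" "\<And>k. \<bar>- p k\<bar> \<le> C * (lattice.norm1 k)\<^sup>2"
    using lattice.quadratic_form_upper_bound p(1) unfolding negative_definite_def by blast
  obtain \<delta> where \<delta>: "\<delta> > 0" "\<And>k. - p k \<le> - \<delta> * (lattice.norm1 k)\<^sup>2"
    using lattice.negative_definite_bound[OF p(1)] by blast
  have "0 \<le> p k" for k
  proof -
    have "0 \<le> \<delta> * (lattice.norm1 k)\<^sup>2" using \<delta>(1) by simp
    then show ?thesis using \<delta>(2)[of k] by linarith
  qed
  moreover have "sqrt (p k) \<le> sqrt C * lattice.norm1 k" for k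
  proof -
    have "sqrt (p k) \<le> sqrt (C * (lattice.norm1 k)\<^sup>2)"
      using C(2)[of k] by (intro real_sqrt_le_mono) linarith
    then show ?thesis by (simp add: real_sqrt_mult lattice.norm1_nonneg)
  qed
  ultimately show ?thesis using that[of "sqrt C"] C(1) by (simp add: p(2))
qed

text \<open>On each of the finitely many cosets the Gaussian bound beats the power of the norm once \<open>\<parallel>b\<parallel>\<close>
  exceeds some threshold; a large Euclidean norm of \<open>r + h b\<close> forces \<open>\<parallel>b\<parallel>\<close> to be large.\<close>

theorem theta_functions_analytic:
  assumes "\<Phi> \<in> theta_functions \<alpha> L"
  shows "analytic_formal \<nu> \<Phi>"
  unfolding analytic_formal_def
proof (intro allI impI)
  fix E :: "'h \<Rightarrow> real" and n :: nat
  assume "euclidean_norm E"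
  then obtain D where D: "D > 0" "\<And>k. E k \<le> D * lattice.norm1 k" "\<And>k. 0 \<le> E k"
    using euclidean_norm_bound by blast
  let ?R = "range coset_rep"
  show "((\<lambda>k. \<nu> (\<Phi> k) * E k ^ n) \<longlongrightarrow> 0) (filtercomap E at_top)"
  proof (rule tendstoI)
    fix e :: real assume "e > 0"
    have "\<exists>s0. \<forall>b. s0 \<le> sub.norm1 b \<longrightarrow> \<nu> (\<Phi> (r + h b)) * E (r + h b) ^ n < e" for r
    proof -
      obtain C \<delta> where \<delta>: "\<delta> > 0"
        and bound: "\<And>b. \<nu> (\<Phi> (r + h b)) \<le> \<nu> (\<Phi> r) * exp (C * sub.norm1 b - \<delta> * (sub.norm1 b)\<^sup>2)"
        by (rule theta_coefficient_bound[OF assms, of r]) blast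
      define G where "G = (\<lambda>s. \<nu> (\<Phi> r) * exp (C * s - \<delta> * s\<^sup>2) * (D * (lattice.norm1 r + s)) ^ n)"
      have "(G \<longlongrightarrow> 0) at_top"
        unfolding G_def using \<delta> D(1) by (rule gaussian_decay)
      then have "eventually (\<lambda>s. G s < e) at_top"
        by (rule order_tendstoD) fact
      then obtain s0 where s0: "\<And>s. s0 \<le> s \<Longrightarrow> G s < e"
        by (auto simp: eventually_at_top_linorder)
      have "\<nu> (\<Phi> (r + h b)) * E (r + h b) ^ n \<le> G (sub.norm1 b)" for b
      proof -
        have "E (r + h b) \<le> D * lattice.norm1 (r + h b)" by (rule D(2))
        also have "\<dots> \<le> D * (lattice.norm1 r + sub.norm1 b)"
          unfolding sub_norm1 using D(1) by (intro mult_left_mono lattice.norm1_add) simp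
        finally show ?thesis
          unfolding G_def using bound[of b] D(3)
          by (intro mult_mono power_mono) (simp_all add: \<nu>_nonneg)
      qed
      then show ?thesis using s0 by (meson le_less_trans)
    qed
    then have "\<forall>r. \<exists>s0. \<forall>b. s0 \<le> sub.norm1 b \<longrightarrow> \<nu> (\<Phi> (r + h b)) * E (r + h b) ^ n < e" ..
    from choice[OF this] obtain s
      where s: "\<And>r b. s r \<le> sub.norm1 b \<Longrightarrow> \<nu> (\<Phi> (r + h b)) * E (r + h b) ^ n < e"
      by blast
    \<comment> \<open>A sum in place of a maximum over the representatives, which bounds all thresholds at once.\<close>
    define B where "B = (\<Sum>r\<in>?R. \<bar>D * (lattice.norm1 r + s r)\<bar>)"
    have "\<nu> (\<Phi> k) * E k ^ n < e" if "B \<le> E k" for k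
    proof -
      define r where "r = coset_rep k"
      obtain b where "k - r = h b" using coset_rep_diff[of k] unfolding r_def by blast
      then have k: "k = r + h b" by (simp add: algebra_simps)
      have "D * (lattice.norm1 r + s r) \<le> B"
        unfolding B_def
        by (rule order_trans[OF abs_ge_self], rule member_le_sum)
          (simp_all add: finite_reps r_def)
      also have "\<dots> \<le> D * lattice.norm1 k" using that D(2) by (rule order_trans)
      also have "\<dots> \<le> D * (lattice.norm1 r + sub.norm1 b)"
        unfolding sub_norm1 k using D(1) by (intro mult_left_mono lattice.norm1_add) simp
      finally have "s r \<le> sub.norm1 b" using D(1) by simp
      then show ?thesis unfolding k by (rule s)
    qed
    moreover have "dist (\<nu> (\<Phi> k) * E k ^ n) 0 = \<nu> (\<Phi> k) * E k ^ n" for k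
      by (simp add: abs_mult D(3) \<nu>_nonneg)
    ultimately have "\<forall>k. B \<le> E k \<longrightarrow> dist (\<nu> (\<Phi> k) * E k ^ n) 0 < e" by simp
    then show "eventually (\<lambda>k. dist (\<nu> (\<Phi> k) * E k ^ n) 0 < e) (filtercomap E at_top)"
      unfolding eventually_filtercomap_at_top_linorder by blast
  qed
qed

end

section \<open>Dimension, analyticity and discreteness\<close>

theorem theorem2p4p1:
  fixes \<alpha> :: "'h::ab_group_add \<Rightarrow> 'h \<Rightarrow> 'k::field"
    and L :: "'b::ab_group_add \<Rightarrow> ('k, 'h) quadruple set"
  assumes "free_of_finite_rank TYPE('h)"
    and "bicharacter \<alpha>"
    and "theta_multiplier \<alpha> L"
  shows
    "edim (theta_functions \<alpha> L) \<le> group_index (range (h_l L))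
     \<and> (depends_only_on_h L \<longrightarrow> edim (theta_functions \<alpha> L) = group_index (range (h_l L)))
     \<and> (inj (h_l L) \<longrightarrow> depends_only_on_h L)
     \<and> (\<forall>\<nu>. field_norm \<nu> \<and> depends_only_on_h L
            \<and> group_index (range (h_l L)) < \<infinity>
            \<and> negative_definite (\<lambda>b. ln (\<nu> (pairing \<alpha> L b b)))
          \<longrightarrow> (complete_field_norm \<nu> \<and> unitary \<nu> \<alpha>
                 \<longrightarrow> (\<forall>\<Phi> \<in> theta_functions \<alpha> L. analytic_formal \<nu> \<Phi>))
            \<and> rk TYPE('b) = rk TYPE('h)
            \<and> (\<forall>S. is_Z_basis S \<longrightarrow> discrete_in (torus_topology \<nu> S) (range (x_l L))))"
proof (intro conjI allI impI ballI; (elim conjE)?)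
  interpret theta_multiplier_group \<alpha> L
    by unfold_locales (fact assms)+
  show "edim (theta_functions \<alpha> L) \<le> group_index (range (h_l L))"
    unfolding theta_functions_eq_invariants by (rule edim_invariants_le)
  show "edim (theta_functions \<alpha> L) = group_index (range (h_l L))" if "depends_only_on_h L"
    unfolding theta_functions_eq_invariants
    by (rule edim_invariants_eq) (rule m_trivial_on_kernel[OF that])
  show "depends_only_on_h L" if "inj (h_l L)"
    using injD[OF that] by (auto simp: depends_only_on_h_def)
  fix \<nu> :: "'k \<Rightarrow> real"
  assume \<nu>: "field_norm \<nu>" "group_index (range (h_l L)) < \<infinity>"
    "negative_definite (\<lambda>b. ln (\<nu> (pairing \<alpha> L b b)))"
  have ample: "ample_multiplier \<alpha> L S \<nu>" if "is_Z_basis S" for S :: "'h set"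
    by unfold_locales (use that \<nu> is_Z_basis_finite[OF assms(1) that] in auto)
  obtain S :: "'h set" where "is_Z_basis S"
    using assms(1) by (auto simp: free_of_finite_rank_def)
  then interpret ample_multiplier \<alpha> L S \<nu> by (rule ample)
  show "analytic_formal \<nu> \<Phi>" if "\<Phi> \<in> theta_functions \<alpha> L" for \<Phi>
    using that by (rule theta_functions_analytic)
  show "rk TYPE('b) = rk TYPE('h)" by (rule rk_eq)
  show "discrete_in (torus_topology \<nu> S) (range (x_l L))" if "is_Z_basis S" for S
    using ample[OF that] by (rule ample_multiplier.period_lattice_discrete)
qed

end
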